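(* Let $G$ be a finitely generated group and let $\chi : \mathfrak{X}(G) \to \mathbb{R}$ be a character. Consider the homomorphisms $\chi_1, \chi_2 : G \to \mathbb{R}$ given by $\chi_1(g) = \chi(g)$ and $\chi_2(g) = \chi(\overline{g})$ for $g \in G$. Then $[\chi] \in \Sigma^1(\mathfrak{X}(G))$ if and only if one of the following holds: 1. $\chi_1 \neq 0$, $\chi_2 \neq 0$ and $\chi_1 \neq \chi_2$; 2. $\chi_1 = 0$ and $[\chi_2] \in \Sigma^1(G)$; 3. $\chi_2 = 0$ and $[\chi_1] \in \Sigma^1(G)$; 4. $\chi_1 = \chi_2 \neq 0$ and $[\chi_1] \in \Sigma^1(G)$. In particular, identifying $S(\mathfrak{X}(G))$ with $S(\mathfrak{X}(G)/W(G))$ via the canonical epimorphism $\mathfrak{X}(G) \to \mathfrak{X}(G)/W(G)$, we have the equality $\Sigma^1(\mathfrak{X}(G)) = \Sigma^1(\mathfrak{X}(G)/W(G))$.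
   Context: For a group $G$ let $\overline{G}$ be an isomorphic copy of $G$, with $\overline{g}$ the image of $g \in G$, and let $\mathfrak{X}(G) = \langle G, \overline{G} \mid [g, \overline{g}] = 1 \text{ for } g \in G\rangle$. Let $L(G) = \langle \overline{g}^{-1} g \mid g \in G\rangle$, $D(G) = [G, \overline{G}]$ (both normal subgroups of $\mathfrak{X}(G)$) and $W(G) = L(G) \cap D(G)$; every homomorphism $\mathfrak{X}(G) \to \mathbb{R}$ vanishes on $W(G)$. A character of a group $H$ is a non-zero homomorphism $\chi : H \to \mathbb{R}$. Two characters are equivalent if one is a positive real multiple of the other; $[\chi]$ is the equivalence class and $S(H)$ is the set of equivalence classes (the character sphere). Put $H_\chi = \{h \in H \mid \chi(h) \geq 0\}$. For a finitely generated group $H$ with finite generating set $X$, let $\Gamma$ be the Cayley graph (vertices $H$, edges from $h$ to $hx$, $x \in X$), and let $\Gamma_\chi$ be its subgraph spanned by $H_\chi$. Then $\Sigma^1(H) = \{[\chi] \in S(H) \mid \Gamma_\chi \text{ is connected}\}$ (independent of the choice of $X$). *)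

theory Defs
  imports Complex_Main "HOL-Algebra.Generated_Groups" "HOL-Algebra.Coset"
    "Graph_Theory.Digraph_Component"
begin

section \<open>Presentations\<close>

inductive_set word_cong :: "'s set \<Rightarrow> ('s list \<times> 's list) set \<Rightarrow> ('s list \<times> 's list) set"
  for S :: "'s set" and R :: "('s list \<times> 's list) set" where
  wc_rel: "(u, v) \<in> R \<Longrightarrow> u \<in> lists S \<Longrightarrow> v \<in> lists S \<Longrightarrow> (u, v) \<in> word_cong S R"
| wc_refl: "u \<in> lists S \<Longrightarrow> (u, u) \<in> word_cong S R"
| wc_sym: "(u, v) \<in> word_cong S R \<Longrightarrow> (v, u) \<in> word_cong S R"
| wc_trans: "(u, v) \<in> word_cong S R \<Longrightarrow> (v, w) \<in> word_cong S R \<Longrightarrow> (u, w) \<in> word_cong S R"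
| wc_append: "(u, v) \<in> word_cong S R \<Longrightarrow> (u', v') \<in> word_cong S R \<Longrightarrow>
    (u @ u', v @ v') \<in> word_cong S R"

text \<open>Words contain no formal inverses, so this is the monoid with generators \<open>S\<close> and
  relations \<open>R\<close>. It coincides with the group given by the same data as soon as the relations
  make every generator invertible.\<close>

definition presented :: "'s set \<Rightarrow> ('s list \<times> 's list) set \<Rightarrow> 's list set monoid" where
  "presented S R =
     \<lparr> carrier = lists S // word_cong S R,
       monoid.mult = (\<lambda>A B. \<Union>a\<in>A. \<Union>b\<in>B. word_cong S R `` {a @ b}),
       one = word_cong S R `` {[]} \<rparr>"


section \<open>The weak commutativity construction\<close>

text \<open>The letters \<open>Inl g\<close> and \<open>Inr g\<close> stand for \<open>g\<close> and for its copy in the second group. The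
  first four sets of relations are the multiplication tables of the two copies (they make every
  letter invertible), the last one consists of the commutators of corresponding elements.\<close>

definition weak_comm_rels :: "('a, 'b) monoid_scheme \<Rightarrow> (('a + 'a) list \<times> ('a + 'a) list) set" where
  "weak_comm_rels G =
     {([Inl g, Inl h], [Inl (g \<otimes>\<^bsub>G\<^esub> h)]) | g h. g \<in> carrier G \<and> h \<in> carrier G} \<union>
     {([Inr g, Inr h], [Inr (g \<otimes>\<^bsub>G\<^esub> h)]) | g h. g \<in> carrier G \<and> h \<in> carrier G} \<union>
     {([Inl \<one>\<^bsub>G\<^esub>], []), ([Inr \<one>\<^bsub>G\<^esub>], [])} \<union>
     {([Inl g, Inr g, Inl (inv\<^bsub>G\<^esub> g), Inr (inv\<^bsub>G\<^esub> g)], []) | g. g \<in> carrier G}"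

definition weak_comm :: "('a, 'b) monoid_scheme \<Rightarrow> ('a + 'a) list set monoid" where
  "weak_comm G = presented (carrier G <+> carrier G) (weak_comm_rels G)"

definition first_copy :: "('a, 'b) monoid_scheme \<Rightarrow> 'a \<Rightarrow> ('a + 'a) list set" where
  "first_copy G g = word_cong (carrier G <+> carrier G) (weak_comm_rels G) `` {[Inl g]}"

definition second_copy :: "('a, 'b) monoid_scheme \<Rightarrow> 'a \<Rightarrow> ('a + 'a) list set" where
  "second_copy G g = word_cong (carrier G <+> carrier G) (weak_comm_rels G) `` {[Inr g]}"

definition commutator_subgroup :: "('a, 'b) monoid_scheme \<Rightarrow> 'a set \<Rightarrow> 'a set \<Rightarrow> 'a set" where
  "commutator_subgroup H A B =
     generate H {a \<otimes>\<^bsub>H\<^esub> b \<otimes>\<^bsub>H\<^esub> inv\<^bsub>H\<^esub> a \<otimes>\<^bsub>H\<^esub> inv\<^bsub>H\<^esub> b | a b. a \<in> A \<and> b \<in> B}"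

definition L_subgroup :: "('a, 'b) monoid_scheme \<Rightarrow> ('a + 'a) list set set" where
  "L_subgroup G = generate (weak_comm G)
     {inv\<^bsub>weak_comm G\<^esub> (second_copy G g) \<otimes>\<^bsub>weak_comm G\<^esub> first_copy G g | g. g \<in> carrier G}"

definition D_subgroup :: "('a, 'b) monoid_scheme \<Rightarrow> ('a + 'a) list set set" where
  "D_subgroup G =
     commutator_subgroup (weak_comm G) (first_copy G ` carrier G) (second_copy G ` carrier G)"

definition W_subgroup :: "('a, 'b) monoid_scheme \<Rightarrow> ('a + 'a) list set set" where
  "W_subgroup G = L_subgroup G \<inter> D_subgroup G"


section \<open>Characters and the character sphere\<close>

definition real_group :: "real monoid" where
  "real_group = \<lparr>carrier = UNIV, monoid.mult = (+), one = 0\<rparr>"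

definition is_character :: "('a, 'b) monoid_scheme \<Rightarrow> ('a \<Rightarrow> real) \<Rightarrow> bool" where
  "is_character H \<chi> \<longleftrightarrow> \<chi> \<in> hom H real_group \<and> (\<exists>h\<in>carrier H. \<chi> h \<noteq> 0)"

text \<open>Only the values of a character on the carrier matter: two functions that agree on the
  carrier represent the same point of the sphere.\<close>

definition char_class :: "('a, 'b) monoid_scheme \<Rightarrow> ('a \<Rightarrow> real) \<Rightarrow> ('a \<Rightarrow> real) set" where
  "char_class H \<chi> = {\<psi>. is_character H \<psi> \<and> (\<exists>r>0. \<forall>h\<in>carrier H. \<psi> h = r * \<chi> h)}"

definition char_sphere :: "('a, 'b) monoid_scheme \<Rightarrow> ('a \<Rightarrow> real) set set" where
  "char_sphere H = char_class H ` {\<chi>. is_character H \<chi>}"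

text \<open>The map \<open>[\<psi>] \<mapsto> [\<psi> \<circ> p]\<close>. All members of a class \<open>C\<close> contribute the same
  class, so the union is that class.\<close>

definition sphere_pullback ::
    "('a, 'b) monoid_scheme \<Rightarrow> ('a \<Rightarrow> 'c) \<Rightarrow> ('c \<Rightarrow> real) set \<Rightarrow> ('a \<Rightarrow> real) set" where
  "sphere_pullback H p C = (\<Union>\<psi>\<in>C. char_class H (\<psi> \<circ> p))"


section \<open>The first Sigma invariant\<close>

definition finite_gen_set :: "('a, 'b) monoid_scheme \<Rightarrow> 'a set \<Rightarrow> bool" where
  "finite_gen_set H X \<longleftrightarrow> finite X \<and> X \<subseteq> carrier H \<and> generate H X = carrier H"

definition finitely_generated :: "('a, 'b) monoid_scheme \<Rightarrow> bool" where
  "finitely_generated H \<longleftrightarrow> (\<exists>X. finite_gen_set H X)"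

definition cayley_graph :: "('a, 'b) monoid_scheme \<Rightarrow> 'a set \<Rightarrow> ('a, 'a \<times> 'a) pre_digraph" where
  "cayley_graph H X =
     \<lparr> verts = carrier H, arcs = carrier H \<times> X,
       tail = fst, head = (\<lambda>(h, x). h \<otimes>\<^bsub>H\<^esub> x) \<rparr>"

definition char_half :: "('a, 'b) monoid_scheme \<Rightarrow> ('a \<Rightarrow> real) \<Rightarrow> 'a set" where
  "char_half H \<chi> = {h \<in> carrier H. \<chi> h \<ge> 0}"

text \<open>Connectedness ignores the orientation of the arcs. The choice of the generating set does
  not matter, see \<open>connected_half_indep\<close> below.\<close>

definition Sigma1 :: "('a, 'b) monoid_scheme \<Rightarrow> ('a \<Rightarrow> real) set set" where
  "Sigma1 H = {char_class H \<chi> | \<chi>. is_character H \<chi> \<and>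
     (\<exists>X. finite_gen_set H X \<and>
        Digraph_Component.connected (cayley_graph H X \<restriction> char_half H \<chi>))}"


section \<open>The weak commutativity construction is a group\<close>

lemma word_cong_lists: "(u, v) \<in> word_cong S R \<Longrightarrow> u \<in> lists S \<and> v \<in> lists S"
  by (induction rule: word_cong.induct) auto

lemma equiv_word_cong: "equiv (lists S) (word_cong S R)"
proof (rule equivI)
  show "word_cong S R \<subseteq> lists S \<times> lists S" using word_cong_lists by fast
  show "refl_on (lists S) (word_cong S R)" by (simp add: refl_on_def wc_refl)
  show "sym (word_cong S R)" by (rule symI) (rule wc_sym)
  show "trans (word_cong S R)" by (rule transI) (rule wc_trans)
qed

lemma word_cong_class_eq_iff:
  assumes "u \<in> lists S" and "v \<in> lists S"
  shows "word_cong S R `` {u} = word_cong S R `` {v} \<longleftrightarrow> (u, v) \<in> word_cong S R"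
  using eq_equiv_class_iff[OF equiv_word_cong assms] by simp

lemma carrier_presented:
  "x \<in> carrier (presented S R) \<longleftrightarrow> (\<exists>u\<in>lists S. x = word_cong S R `` {u})"
  by (auto simp: presented_def quotient_def)

lemma mult_presented:
  assumes u: "u \<in> lists S" and v: "v \<in> lists S"
  shows "word_cong S R `` {u} \<otimes>\<^bsub>presented S R\<^esub> word_cong S R `` {v} = word_cong S R `` {u @ v}"
proof -
  have "word_cong S R `` {a @ b} = word_cong S R `` {u @ v}"
    if "a \<in> word_cong S R `` {u}" and "b \<in> word_cong S R `` {v}" for a b
  proof (rule equiv_class_eq[OF equiv_word_cong])
    show "(a @ b, u @ v) \<in> word_cong S R"
      using that by (simp add: wc_append wc_sym)
  qed
  then have "(\<Union>a\<in>word_cong S R `` {u}. \<Union>b\<in>word_cong S R `` {v}. word_cong S R `` {a @ b})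
      = (\<Union>a\<in>word_cong S R `` {u}. \<Union>b\<in>word_cong S R `` {v}. word_cong S R `` {u @ v})"
    by (intro SUP_cong) simp_all
  also have "\<dots> = word_cong S R `` {u @ v}"
  proof -
    have "u \<in> word_cong S R `` {u}" and "v \<in> word_cong S R `` {v}"
      using u v by (simp_all add: wc_refl)
    then show ?thesis by blast
  qed
  finally show ?thesis by (simp add: presented_def)
qed

lemma one_presented: "\<one>\<^bsub>presented S R\<^esub> = word_cong S R `` {[]}"
  by (simp add: presented_def)

lemma monoid_presented: "monoid (presented S R)"
proof (rule monoidI)
  fix x y assume "x \<in> carrier (presented S R)" "y \<in> carrier (presented S R)"
  then show "x \<otimes>\<^bsub>presented S R\<^esub> y \<in> carrier (presented S R)"
    unfolding carrier_presented by (metis append_in_lists_conv mult_presented)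
next
  show "\<one>\<^bsub>presented S R\<^esub> \<in> carrier (presented S R)"
    unfolding carrier_presented one_presented by auto
next
  fix x y z
  assume "x \<in> carrier (presented S R)" "y \<in> carrier (presented S R)" "z \<in> carrier (presented S R)"
  then obtain u v w where "u \<in> lists S" "v \<in> lists S" "w \<in> lists S"
    "x = word_cong S R `` {u}" "y = word_cong S R `` {v}" "z = word_cong S R `` {w}"
    unfolding carrier_presented by blast
  then show "(x \<otimes>\<^bsub>presented S R\<^esub> y) \<otimes>\<^bsub>presented S R\<^esub> z
      = x \<otimes>\<^bsub>presented S R\<^esub> (y \<otimes>\<^bsub>presented S R\<^esub> z)"
    by (simp add: mult_presented)
next
  fix x assume "x \<in> carrier (presented S R)"
  then obtain u where u: "u \<in> lists S" and x: "x = word_cong S R `` {u}"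
    unfolding carrier_presented by blast
  have nil: "[] \<in> lists S" by simp
  show "\<one>\<^bsub>presented S R\<^esub> \<otimes>\<^bsub>presented S R\<^esub> x = x"
    unfolding one_presented x mult_presented[OF nil u] by simp
  show "x \<otimes>\<^bsub>presented S R\<^esub> \<one>\<^bsub>presented S R\<^esub> = x"
    unfolding one_presented x mult_presented[OF u nil] by simp
qed

lemma group_presented:
  assumes inv: "\<And>s. s \<in> S \<Longrightarrow> \<exists>s'\<in>S. ([s', s], []) \<in> word_cong S R"
  shows "group (presented S R)"
proof -
  interpret monoid "presented S R" by (rule monoid_presented)
  have *: "\<exists>v\<in>lists S. (v @ u, []) \<in> word_cong S R" if "u \<in> lists S" for u
    using that
  proof (induction u)
    case Nil
    show ?case by (rule bexI[of _ "[]"]) (auto intro: wc_refl)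
  next
    case (Cons s u)
    then obtain v where v: "v \<in> lists S" "(v @ u, []) \<in> word_cong S R" by blast
    obtain s' where s': "s' \<in> S" "([s', s], []) \<in> word_cong S R" using inv Cons by blast
    have "([s', s] @ u, [] @ u) \<in> word_cong S R"
      by (rule wc_append) (use s' Cons in \<open>auto intro: wc_refl\<close>)
    then have "(v @ ([s', s] @ u), v @ ([] @ u)) \<in> word_cong S R"
      by (rule wc_append[rotated]) (use v in \<open>auto intro: wc_refl\<close>)
    then have "((v @ [s']) @ (s # u), []) \<in> word_cong S R"
      using wc_trans[OF _ v(2)] by simp
    then show ?case using v s' by (intro bexI[of _ "v @ [s']"]) auto
  qed
  show ?thesis
  proof (rule groupI)
    fix x assume "x \<in> carrier (presented S R)"
    then obtain u where u: "u \<in> lists S" "x = word_cong S R `` {u}"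
      unfolding carrier_presented by blast
    from *[OF u(1)] obtain v where v: "v \<in> lists S" "(v @ u, []) \<in> word_cong S R" by blast
    show "\<exists>y\<in>carrier (presented S R). y \<otimes>\<^bsub>presented S R\<^esub> x = \<one>\<^bsub>presented S R\<^esub>"
    proof (rule bexI)
      show "word_cong S R `` {v} \<otimes>\<^bsub>presented S R\<^esub> x = \<one>\<^bsub>presented S R\<^esub>"
        unfolding u(2) mult_presented[OF v(1) u(1)] one_presented
        by (rule equiv_class_eq[OF equiv_word_cong v(2)])
      show "word_cong S R `` {v} \<in> carrier (presented S R)"
        unfolding carrier_presented using v by blast
    qed
  qed (auto simp: m_assoc)
qed

lemma group_weak_comm:
  fixes G (structure)
  assumes "group G"
  shows "group (weak_comm G)"
  unfolding weak_comm_def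
proof (rule group_presented)
  interpret group G by fact
  let ?S = "carrier G <+> carrier G"
  let ?E = "word_cong ?S (weak_comm_rels G)"
  fix s assume "s \<in> ?S"
  then consider g where "g \<in> carrier G" "s = Inl g" | g where "g \<in> carrier G" "s = Inr g" by blast
  then show "\<exists>s'\<in>?S. ([s', s], []) \<in> ?E"
  proof cases
    case (1 g)
    have "([Inl (inv g), Inl g], [Inl (inv g \<otimes> g)]) \<in> ?E"
      by (rule wc_rel) (use 1 in \<open>auto simp: weak_comm_rels_def\<close>)
    moreover have "([Inl \<one>], []) \<in> ?E"
      by (rule wc_rel) (auto simp: weak_comm_rels_def)
    ultimately have "([Inl (inv g), Inl g], []) \<in> ?E"
      using 1 wc_trans by fastforce
    then show ?thesis using 1 by (intro bexI[of _ "Inl (inv g)"]) auto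
  next
    case (2 g)
    have "([Inr (inv g), Inr g], [Inr (inv g \<otimes> g)]) \<in> ?E"
      by (rule wc_rel) (use 2 in \<open>auto simp: weak_comm_rels_def\<close>)
    moreover have "([Inr \<one>], []) \<in> ?E"
      by (rule wc_rel) (auto simp: weak_comm_rels_def)
    ultimately have "([Inr (inv g), Inr g], []) \<in> ?E"
      using 2 wc_trans by fastforce
    then show ?thesis using 2 by (intro bexI[of _ "Inr (inv g)"]) auto
  qed
qed


section \<open>Independence of the generating set\<close>

definition half_conn ::
    "('a, 'b) monoid_scheme \<Rightarrow> ('a \<Rightarrow> real) \<Rightarrow> 'a set \<Rightarrow> real \<Rightarrow> 'a \<Rightarrow> 'a \<Rightarrow> bool" where
  "half_conn H \<chi> X c u v \<longleftrightarrow> (u, v) \<in> rtrancl_on {h \<in> carrier H. \<chi> h \<ge> c}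
     {(a, b). \<exists>x\<in>X. b = a \<otimes>\<^bsub>H\<^esub> x \<or> a = b \<otimes>\<^bsub>H\<^esub> x}"

lemma rtrancl_on_restrict:
  "rtrancl_on F (r \<inter> F \<times> F) = rtrancl_on F r"
proof -
  have "(a, b) \<in> rtrancl_on F (r \<inter> F \<times> F) \<longleftrightarrow> (a, b) \<in> rtrancl_on F r" for a b
  proof
    show "(a, b) \<in> rtrancl_on F r" if "(a, b) \<in> rtrancl_on F (r \<inter> F \<times> F)"
      using that by (induction rule: rtrancl_on_induct) (auto intro: rtrancl_on_into_rtrancl_on)
    show "(a, b) \<in> rtrancl_on F (r \<inter> F \<times> F)" if "(a, b) \<in> rtrancl_on F r"
      using that by (induction rule: rtrancl_on_induct) (auto intro: rtrancl_on_into_rtrancl_on)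
  qed
  then show ?thesis by auto
qed

lemma connected_half_iff:
  assumes "char_half H \<chi> \<noteq> {}"
  shows "Digraph_Component.connected (cayley_graph H X \<restriction> char_half H \<chi>) \<longleftrightarrow>
    (\<forall>u\<in>char_half H \<chi>. \<forall>v\<in>char_half H \<chi>. half_conn H \<chi> X 0 u v)"
proof -
  let ?S = "char_half H \<chi>"
  let ?r = "{(a, b). \<exists>x\<in>X. b = a \<otimes>\<^bsub>H\<^esub> x \<or> a = b \<otimes>\<^bsub>H\<^esub> x}"
  have "parcs (mk_symmetric (cayley_graph H X \<restriction> ?S)) = ?r \<inter> ?S \<times> ?S"
    unfolding mk_symmetric_def cayley_graph_def char_half_def by (auto; force)
  then show ?thesis
    using assms
    by (simp add: Digraph_Component.connected_def strongly_connected_def reachable_def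
        rtrancl_on_restrict half_conn_def char_half_def)
qed

context group
begin

lemma is_character_mult:
  "is_character G \<chi> \<Longrightarrow> a \<in> carrier G \<Longrightarrow> b \<in> carrier G \<Longrightarrow> \<chi> (a \<otimes> b) = \<chi> a + \<chi> b"
  by (simp add: is_character_def hom_def real_group_def)

lemma is_character_one: "is_character G \<chi> \<Longrightarrow> \<chi> \<one> = 0"
  using is_character_mult[of \<chi> \<one> \<one>] by simp

lemma is_character_inv: "is_character G \<chi> \<Longrightarrow> a \<in> carrier G \<Longrightarrow> \<chi> (inv a) = - \<chi> a"
  using is_character_mult[of \<chi> "inv a" a] is_character_one[of \<chi>] by simp

lemma half_conn_trans:
  "half_conn G \<chi> X c u v \<Longrightarrow> half_conn G \<chi> X c v w \<Longrightarrow> half_conn G \<chi> X c u w"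
  unfolding half_conn_def by (rule rtrancl_on_trans)

lemma half_conn_sym:
  assumes "half_conn G \<chi> X c u v"
  shows "half_conn G \<chi> X c v u"
  using assms unfolding half_conn_def
proof (induction rule: rtrancl_on_induct)
  case (step y z)
  have "(z, y) \<in> {(a, b). \<exists>x\<in>X. b = a \<otimes> x \<or> a = b \<otimes> x}" using step by auto
  then show ?case using step by (meson converse_rtrancl_on_into_rtrancl_on)
qed auto

lemma half_conn_mono:
  assumes "half_conn G \<chi> X c u v" and "d \<le> c"
  shows "half_conn G \<chi> X d u v"
  using assms(1) unfolding half_conn_def
  by (induction rule: rtrancl_on_induct) (use assms(2) in \<open>auto intro: rtrancl_on_into_rtrancl_on\<close>)

lemma half_conn_translate:
  assumes \<chi>: "is_character G \<chi>" and X: "X \<subseteq> carrier G" and g: "g \<in> carrier G"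
    and "half_conn G \<chi> X c u v" and "d = \<chi> g + c"
  shows "half_conn G \<chi> X d (g \<otimes> u) (g \<otimes> v)"
  using assms(4) unfolding half_conn_def
proof (induction rule: rtrancl_on_induct)
  case base
  then show ?case using assms by (auto simp: is_character_mult)
next
  case (step y z)
  then have "\<exists>x\<in>X. g \<otimes> z = (g \<otimes> y) \<otimes> x \<or> g \<otimes> y = (g \<otimes> z) \<otimes> x"
    using g X by (auto simp: subset_iff m_assoc)
  then show ?case
    using step assms by (intro rtrancl_on_into_rtrancl_on[OF step.IH]) (auto simp: is_character_mult)
qed

lemma half_conn_step:
  assumes "is_character G \<chi>" and "X \<subseteq> carrier G" and "x \<in> X"
  shows "half_conn G \<chi> X (min 0 (\<chi> x)) \<one> x"
  unfolding half_conn_def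
  by (rule rtrancl_on_into_rtrancl_on[OF rtrancl_on_refl])
    (use assms in \<open>auto simp: is_character_one subset_iff\<close>)

lemma half_conn_step_inv:
  assumes \<chi>: "is_character G \<chi>" and X: "X \<subseteq> carrier G" and x: "x \<in> X"
  shows "half_conn G \<chi> X (min 0 (- \<chi> x)) \<one> (inv x)"
proof -
  have xG: "x \<in> carrier G" using X x by blast
  have "half_conn G \<chi> X (min 0 (- \<chi> x)) (inv x \<otimes> \<one>) (inv x \<otimes> x)"
    by (rule half_conn_translate[OF \<chi> X _ half_conn_step[OF \<chi> X x]])
      (use xG \<chi> in \<open>auto simp: is_character_inv\<close>)
  then show ?thesis using xG half_conn_sym by simp
qed

lemma half_conn_generate:
  assumes \<chi>: "is_character G \<chi>" and X: "X \<subseteq> carrier G" and "h \<in> generate G X"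
  shows "\<exists>c. half_conn G \<chi> X c \<one> h"
  using assms(3)
proof induction
  case one
  have "half_conn G \<chi> X 0 \<one> \<one>"
    unfolding half_conn_def by (auto simp: is_character_one[OF \<chi>])
  then show ?case by blast
next
  case (incl h)
  then show ?case using half_conn_step[OF \<chi> X] by blast
next
  case (inv h)
  then show ?case using half_conn_step_inv[OF \<chi> X] by blast
next
  case (eng h1 h2)
  then obtain c1 c2 where c: "half_conn G \<chi> X c1 \<one> h1" "half_conn G \<chi> X c2 \<one> h2" by blast
  have h1: "h1 \<in> carrier G" using eng generate_in_carrier[OF X] by blast
  have "half_conn G \<chi> X (\<chi> h1 + c2) h1 (h1 \<otimes> h2)"
    using half_conn_translate[OF \<chi> X h1 c(2) refl] h1 by simp
  then have "half_conn G \<chi> X (min c1 (\<chi> h1 + c2)) \<one> (h1 \<otimes> h2)"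
    using c(1) by (meson half_conn_mono half_conn_trans min.cobounded1 min.cobounded2)
  then show ?case by blast
qed

lemma half_conn_change_gens:
  assumes \<chi>: "is_character G \<chi>" and X: "X \<subseteq> carrier G" and Y: "Y \<subseteq> carrier G"
    and N: "\<And>x. x \<in> X \<Longrightarrow> half_conn G \<chi> Y (- N) \<one> x" and N0: "0 \<le> N"
    and "half_conn G \<chi> X c u v"
  shows "half_conn G \<chi> Y (c - N) u v"
proof -
  have edge: "half_conn G \<chi> Y (c - N) y (y \<otimes> x)"
    if "y \<in> carrier G" "\<chi> y \<ge> c" "x \<in> X" for x y
  proof -
    have "half_conn G \<chi> Y (\<chi> y + (- N)) (y \<otimes> \<one>) (y \<otimes> x)"
      by (rule half_conn_translate[OF \<chi> Y that(1) N[OF that(3)] refl])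
    then show ?thesis using that by (auto intro: half_conn_mono)
  qed
  have "(u, v) \<in> rtrancl_on {h \<in> carrier G. \<chi> h \<ge> c} {(a, b). \<exists>x\<in>X. b = a \<otimes> x \<or> a = b \<otimes> x}"
    using assms(6) unfolding half_conn_def .
  then show ?thesis
  proof (induction rule: rtrancl_on_induct)
    case base
    then show ?case using N0 unfolding half_conn_def by auto
  next
    case (step y z)
    then have "half_conn G \<chi> Y (c - N) y z"
      using edge half_conn_sym by blast
    then show ?case using step.IH half_conn_trans by blast
  qed
qed

lemma character_positive_elem:
  assumes \<chi>: "is_character G \<chi>" and Y: "finite_gen_set G Y"
  obtains t where "t \<in> carrier G" and "\<chi> t > 0" and "half_conn G \<chi> Y 0 \<one> t"
proof -
  have Y1: "Y \<subseteq> carrier G" and Y2: "generate G Y = carrier G"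
    using Y by (auto simp: finite_gen_set_def)
  have "\<exists>y\<in>Y. \<chi> y \<noteq> 0"
  proof (rule ccontr)
    assume *: "\<not> ?thesis"
    have "\<chi> h = 0" if "h \<in> generate G Y" for h
      using that
    proof induction
      case (eng h1 h2)
      then show ?case using is_character_mult[OF \<chi>] Y2 by simp
    qed (use * \<chi> Y1 in \<open>auto simp: is_character_one is_character_inv subset_iff\<close>)
    then show False using \<chi> Y2 by (auto simp: is_character_def)
  qed
  then obtain y where y: "y \<in> Y" "\<chi> y \<noteq> 0" by blast
  then have yG: "y \<in> carrier G" using Y1 by blast
  show thesis
  proof (cases "\<chi> y > 0")
    case True
    then show thesis using that[of y] half_conn_step[OF \<chi> Y1 y(1)] yG by simp
  next
    case False
    then show thesis
      using that[of "inv y"] half_conn_step_inv[OF \<chi> Y1 y(1)] yG y is_character_inv[OF \<chi> yG]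
      by simp
  qed
qed

lemma character_large_elem:
  assumes \<chi>: "is_character G \<chi>" and Y: "finite_gen_set G Y"
  obtains t where "t \<in> carrier G" and "\<chi> t \<ge> N" and "half_conn G \<chi> Y 0 \<one> t"
proof -
  have Y1: "Y \<subseteq> carrier G" using Y by (auto simp: finite_gen_set_def)
  obtain t where t: "t \<in> carrier G" "\<chi> t > 0" "half_conn G \<chi> Y 0 \<one> t"
    using character_positive_elem[OF \<chi> Y] .
  have pow: "\<chi> (t [^] k) = real k * \<chi> t \<and> half_conn G \<chi> Y 0 \<one> (t [^] k)" for k :: nat
  proof (induction k)
    case 0
    then show ?case
      using is_character_one[OF \<chi>] unfolding half_conn_def by auto
  next
    case (Suc k)
    have tk: "t [^] k \<in> carrier G" using t by simp
    have "half_conn G \<chi> Y (\<chi> (t [^] k) + 0) (t [^] k \<otimes> \<one>) (t [^] k \<otimes> t)"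
      by (rule half_conn_translate[OF \<chi> Y1 tk t(3) refl])
    moreover have "0 \<le> \<chi> (t [^] k) + 0" using Suc t by simp
    ultimately have "half_conn G \<chi> Y 0 (t [^] k) (t [^] k \<otimes> t)"
      using half_conn_mono[of \<chi> Y _ "t [^] k" "t [^] k \<otimes> t" 0] tk by simp
    then have "half_conn G \<chi> Y 0 \<one> (t [^] Suc k)"
      using half_conn_trans[of \<chi> Y 0 \<one> "t [^] k" "t [^] k \<otimes> t"] Suc by simp
    moreover have "\<chi> (t [^] Suc k) = real (Suc k) * \<chi> t"
      using Suc is_character_mult[OF \<chi> tk t(1)] by (simp add: algebra_simps)
    ultimately show ?case by simp
  qed
  obtain k :: nat where "N < real k * \<chi> t" using t(2) reals_Archimedean3 by blast
  then show thesis using that[of "t [^] k"] pow[of k] t(1) by simp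
qed

lemma connected_half_indep:
  assumes \<chi>: "is_character G \<chi>" and X: "finite_gen_set G X" and Y: "finite_gen_set G Y"
    and con: "Digraph_Component.connected (cayley_graph G X \<restriction> char_half G \<chi>)"
  shows "Digraph_Component.connected (cayley_graph G Y \<restriction> char_half G \<chi>)"
proof -
  have one: "\<one> \<in> char_half G \<chi>" using is_character_one[OF \<chi>] by (simp add: char_half_def)
  then have ne: "char_half G \<chi> \<noteq> {}" by blast
  have X1: "X \<subseteq> carrier G" "finite X" and Y1: "Y \<subseteq> carrier G"
    and Y2: "generate G Y = carrier G"
    using X Y by (auto simp: finite_gen_set_def)
  have "\<forall>x\<in>X. \<exists>c. half_conn G \<chi> Y c \<one> x"
    using half_conn_generate[OF \<chi> Y1] Y2 X1 by blast
  then obtain c where c: "\<And>x. x \<in> X \<Longrightarrow> half_conn G \<chi> Y (c x) \<one> x" by metis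
  define N where "N = (\<Sum>x\<in>X. \<bar>c x\<bar>)"
  have N0: "0 \<le> N" by (simp add: N_def sum_nonneg)
  have N: "half_conn G \<chi> Y (- N) \<one> x" if "x \<in> X" for x
  proof -
    have "\<bar>c x\<bar> \<le> N" unfolding N_def using that X1 by (intro member_le_sum) auto
    then show ?thesis using c[OF that] by (auto intro: half_conn_mono)
  qed
  obtain t where t: "t \<in> carrier G" "\<chi> t \<ge> N" "half_conn G \<chi> Y 0 \<one> t"
    using character_large_elem[OF \<chi> Y] .
  have from_one: "half_conn G \<chi> Y 0 \<one> h" if h: "h \<in> char_half G \<chi>" for h
  proof -
    have hG: "h \<in> carrier G" and h0: "\<chi> h \<ge> 0" using h by (auto simp: char_half_def)
    let ?k = "inv t \<otimes> (h \<otimes> t)"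
    have "\<chi> ?k = \<chi> h"
      using t(1) hG \<chi> by (simp add: is_character_mult is_character_inv)
    then have "?k \<in> char_half G \<chi>" using t(1) hG h0 by (simp add: char_half_def)
    then have "half_conn G \<chi> X 0 \<one> ?k"
      using con one unfolding connected_half_iff[OF ne] by blast
    then have "half_conn G \<chi> Y (0 - N) \<one> ?k"
      using half_conn_change_gens[OF \<chi> X1(1) Y1 N N0] by blast
    then have "half_conn G \<chi> Y (\<chi> t + (0 - N)) (t \<otimes> \<one>) (t \<otimes> ?k)"
      by (rule half_conn_translate[OF \<chi> Y1 t(1) _ refl])
    moreover have "t \<otimes> ?k = h \<otimes> t"
      using t(1) hG by (simp flip: m_assoc)
    ultimately have 1: "half_conn G \<chi> Y 0 t (h \<otimes> t)"
      using t by (auto intro: half_conn_mono)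
    have "half_conn G \<chi> Y (\<chi> h + 0) (h \<otimes> \<one>) (h \<otimes> t)"
      by (rule half_conn_translate[OF \<chi> Y1 hG t(3) refl])
    then have 2: "half_conn G \<chi> Y 0 (h \<otimes> t) h"
      using h0 hG by (auto intro: half_conn_mono half_conn_sym)
    show ?thesis using t(3) 1 2 half_conn_trans by blast
  qed
  show ?thesis
    unfolding connected_half_iff[OF ne]
    by (intro ballI half_conn_trans[OF half_conn_sym[OF from_one] from_one])
qed

end

end

theory Submission
  imports Defs
begin

text \<open>Write \<open>X\<close> for the weak commutativity group of \<open>G\<close>, and \<open>g\<close>, \<open>g'\<close> for the two copies in \<open>X\<close> of
  an element of \<open>G\<close>. For a character \<open>\<chi>\<close> of \<open>X\<close>, let \<open>\<chi>\<^sub>1 g = \<chi> g\<close> and \<open>\<chi>\<^sub>2 g = \<chi> g'\<close>.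

  Fix a character \<open>\<chi>\<close> of a finitely generated group \<open>H\<close> and an element \<open>t\<close> with \<open>\<chi> t > 0\<close>. The translated rays
  \<open>n \<mapsto> h t\<^sup>n\<close> run upwards in the Cayley graph. Two of them have the same end if, for every \<open>c\<close>,
  their tails are connected inside the part where \<open>\<chi> \<ge> c\<close>. The elements \<open>h\<close> whose ray has the same
  end as the ray of \<open>1\<close> form a subgroup \<open>K\<^sub>t\<close>, and \<open>[\<chi>] \<in> \<Sigma>\<^sup>1(H)\<close> says that \<open>K\<^sub>t = H\<close>
  (\<open>Sigma1_iff_end_stab\<close>). Two properties carry the argument: if \<open>s \<in> K\<^sub>t\<close> and \<open>\<chi> s > 0\<close>, then
  \<open>K\<^sub>s = K\<^sub>t\<close> (\<open>end_stab_eq\<close>); and if \<open>s \<in> K\<^sub>t\<close>, \<open>\<chi> s \<noteq> 0\<close> and \<open>h s h\<^sup>-\<^sup>1 \<in> K\<^sub>t\<close>, then \<open>h \<in> K\<^sub>t\<close>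
  (\<open>end_stab_absorbs\<close>). In particular \<open>K\<^sub>t\<close> contains the centralizer of each of its elements on which
  \<open>\<chi>\<close> does not vanish.

  Suppose that \<open>\<chi>\<^sub>1\<close> and \<open>\<chi>\<^sub>2\<close> are non-zero and distinct. Choose \<open>g\<close> with \<open>\<chi>\<^sub>1 g \<noteq> 0\<close> and
  \<open>\<chi>\<^sub>1 g \<noteq> \<chi>\<^sub>2 g\<close>, and let \<open>t\<close> be \<open>g'\<^sup>-\<^sup>1 g\<close> or its inverse. The element \<open>t\<close> commutes with \<open>g\<close> and,
  by a computation of Sidki, with every commutator \<open>[h, k']\<close> (\<open>l_commutes\<close>). So \<open>K\<^sub>t\<close> contains \<open>g\<close>
  and all these commutators, hence all \<open>k' g k'\<^sup>-\<^sup>1\<close>, hence all \<open>k'\<close>; with some \<open>h'\<close> such that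
  \<open>\<chi>\<^sub>2 h \<noteq> 0\<close> in the role of \<open>g\<close>, it then contains all \<open>k\<close>, and \<open>K\<^sub>t = X\<close>.

  In the other cases the hypothesis on \<open>\<Sigma>\<^sup>1(G)\<close> puts one of the copies into \<open>K\<^sub>t\<close>, for \<open>t\<close> in that
  copy, and the commutation of \<open>g\<close> with \<open>g'\<close> brings in the other one. Conversely, if \<open>\<chi>\<^sub>1 = 0\<close>,
  \<open>\<chi>\<^sub>2 = 0\<close> or \<open>\<chi>\<^sub>1 = \<chi>\<^sub>2\<close>, then \<open>\<chi>\<close> factors through one of three retractions of \<open>X\<close> onto \<open>G\<close>
  (kill a copy, or identify the two), and connectedness passes to images.

  This only uses that \<open>X\<close> is generated by two elementwise commuting images of \<open>G\<close> and has these
  three retractions. Each retraction kills \<open>L(G)\<close> or \<open>D(G)\<close>, so it descends to \<open>X/W(G)\<close>. Therefore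
  the same criterion, in terms of the same \<open>\<chi>\<^sub>1\<close> and \<open>\<chi>\<^sub>2\<close>, decides membership in
  \<open>\<Sigma>\<^sup>1(X/W(G))\<close>, and the two invariants correspond.\<close>

section \<open>Ends of the Cayley graph in the direction of a character\<close>

text \<open>Two sequences have the same end if for every height \<open>c\<close> their tails lie in one component of the
  part of the Cayley graph where \<open>\<chi> \<ge> c\<close>. The two indices vary independently, so that
  \<open>same_end H \<chi> Y u u\<close> says that the single sequence \<open>u\<close> converges to an end.\<close>

definition same_end ::
    "('a, 'b) monoid_scheme \<Rightarrow> ('a \<Rightarrow> real) \<Rightarrow> 'a set \<Rightarrow> (nat \<Rightarrow> 'a) \<Rightarrow> (nat \<Rightarrow> 'a) \<Rightarrow> bool" where
  "same_end H \<chi> Y u v \<longleftrightarrow> (\<forall>c. \<exists>N. \<forall>m\<ge>N. \<forall>n\<ge>N. half_conn H \<chi> Y c (u m) (v n))"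

text \<open>The subgroup \<open>K\<^sub>t\<close>: the elements that fix the end of the ray \<open>n \<mapsto> t\<^sup>n\<close>. It is
  meaningful only for \<open>\<chi> t > 0\<close>.\<close>

definition end_stab ::
    "('a, 'b) monoid_scheme \<Rightarrow> ('a \<Rightarrow> real) \<Rightarrow> 'a set \<Rightarrow> 'a \<Rightarrow> 'a set" where
  "end_stab H \<chi> Y t = {h \<in> carrier H.
     same_end H \<chi> Y (\<lambda>n. h \<otimes>\<^bsub>H\<^esub> t [^]\<^bsub>H\<^esub> n) (\<lambda>n. t [^]\<^bsub>H\<^esub> n)}"

text \<open>A group with a character and a generating set \<open>Y\<close>, which need not be finite here.\<close>

locale character_group = group G for G (structure) +
  fixes \<chi> :: "'a \<Rightarrow> real" and Y :: "'a set"
  assumes char: "is_character G \<chi>"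
    and gens: "Y \<subseteq> carrier G"
    and generate_gens: "generate G Y = carrier G"
begin

abbreviation conn :: "real \<Rightarrow> 'a \<Rightarrow> 'a \<Rightarrow> bool" where
  "conn \<equiv> half_conn G \<chi> Y"

abbreviation eq_end :: "(nat \<Rightarrow> 'a) \<Rightarrow> (nat \<Rightarrow> 'a) \<Rightarrow> bool" (infix \<open>\<approx>\<close> 50) where
  "u \<approx> v \<equiv> same_end G \<chi> Y u v"

abbreviation stab :: "'a \<Rightarrow> 'a set" where
  "stab \<equiv> end_stab G \<chi> Y"

lemma char_pow: "t \<in> carrier G \<Longrightarrow> \<chi> (t [^] (n::nat)) = real n * \<chi> t"
  by (induction n)
    (simp_all add: is_character_one[OF char] is_character_mult[OF char] algebra_simps)

lemmas char_simps [simp] =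
  is_character_one[OF char] is_character_mult[OF char] is_character_inv[OF char] char_pow

lemma conn_translate:
  assumes "conn d u v" and "g \<in> carrier G" and "c \<le> \<chi> g + d"
  shows "conn c (g \<otimes> u) (g \<otimes> v)"
  using half_conn_mono[OF half_conn_translate[OF char gens assms(2,1) refl] assms(3)] .

lemma conn_exists:
  assumes "h \<in> carrier G"
  obtains d where "conn d \<one> h"
  using half_conn_generate[OF char gens] assms generate_gens by blast

text \<open>A path from \<open>\<one>\<close> to \<open>t\<close> at height at least \<open>d\<close> gives, by translation, paths between the points of
  the ray \<open>n \<mapsto> h t\<^sup>n\<close> from index \<open>m\<close> on. Since the ray rises, they never fall more than \<open>-d\<close> below
  \<open>h t\<^sup>m\<close>, however far they go.\<close>

lemma conn_ray:
  assumes "conn d \<one> t" and "t \<in> carrier G" and "\<chi> t > 0" and "h \<in> carrier G"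
    and "c \<le> \<chi> h + real m * \<chi> t + d" and "m \<le> n"
  shows "conn c (h \<otimes> t [^] m) (h \<otimes> t [^] n)"
  using assms(6)
proof (induction n rule: dec_induct)
  case base
  have "conn c ((h \<otimes> t [^] m) \<otimes> \<one>) ((h \<otimes> t [^] m) \<otimes> t)"
    using assms by (intro conn_translate[OF assms(1)]) auto
  then have "conn c (h \<otimes> t [^] m) (h \<otimes> t [^] m \<otimes> t)" using assms by simp
  from half_conn_trans[OF this half_conn_sym[OF this]] show ?case .
next
  case (step n)
  have "real m * \<chi> t \<le> real n * \<chi> t"
    using step.hyps assms(3) by (intro mult_right_mono) auto
  then have "c \<le> \<chi> h + real n * \<chi> t + d" using assms(5) by linarith
  then have "conn c ((h \<otimes> t [^] n) \<otimes> \<one>) ((h \<otimes> t [^] n) \<otimes> t)"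
    using assms(2-4) by (intro conn_translate[OF assms(1)]) auto
  then have "conn c (h \<otimes> t [^] n) (h \<otimes> t [^] Suc n)"
    using assms by (simp add: m_assoc)
  then show ?case by (rule half_conn_trans[OF step.IH])
qed

lemma large_multiple:
  assumes "(0::real) < r"
  obtains N :: nat where "\<And>n. N \<le> n \<Longrightarrow> c \<le> real n * r"
proof -
  obtain N :: nat where N: "c < real N * r" using assms reals_Archimedean3 by blast
  have "c \<le> real n * r" if "N \<le> n" for n
  proof -
    have "real N * r \<le> real n * r" using that assms by (intro mult_right_mono) auto
    then show ?thesis using N by simp
  qed
  then show thesis using that by blast
qed

lemma same_endE:
  assumes "u \<approx> v"
  obtains N where "\<And>m n. N \<le> m \<Longrightarrow> N \<le> n \<Longrightarrow> conn c (u m) (v n)"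
  using assms that unfolding same_end_def by blast

lemma same_end_sym: "u \<approx> v \<Longrightarrow> v \<approx> u"
  unfolding same_end_def using half_conn_sym[of \<chi> Y] by fast

lemma same_end_trans:
  assumes "u \<approx> v" and "v \<approx> w"
  shows "u \<approx> w"
  unfolding same_end_def
proof
  fix c
  obtain N1 where N1: "\<And>m n. N1 \<le> m \<Longrightarrow> N1 \<le> n \<Longrightarrow> conn c (u m) (v n)"
    by (fact same_endE[OF assms(1), where c = c])
  obtain N2 where N2: "\<And>m n. N2 \<le> m \<Longrightarrow> N2 \<le> n \<Longrightarrow> conn c (v m) (w n)"
    by (fact same_endE[OF assms(2), where c = c])
  have "conn c (u m) (w n)" if "max N1 N2 \<le> m" "max N1 N2 \<le> n" for m n
    using that by (intro half_conn_trans[OF N1[of m "max N1 N2"] N2[of "max N1 N2" n]]) auto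
  then show "\<exists>N::nat. \<forall>m\<ge>N. \<forall>n\<ge>N. conn c (u m) (w n)" by blast
qed

lemma same_end_translate:
  assumes "u \<approx> v" and "g \<in> carrier G"
  shows "(\<lambda>n. g \<otimes> u n) \<approx> (\<lambda>n. g \<otimes> v n)"
  unfolding same_end_def
proof
  fix c
  obtain N where "\<And>m n. N \<le> m \<Longrightarrow> N \<le> n \<Longrightarrow> conn (c - \<chi> g) (u m) (v n)"
    by (fact same_endE[OF assms(1), where c = "c - \<chi> g"])
  then have "\<forall>m\<ge>N. \<forall>n\<ge>N. conn c (g \<otimes> u m) (g \<otimes> v n)"
    using conn_translate[OF _ assms(2), of "c - \<chi> g" _ _ c] by simp
  then show "\<exists>N::nat. \<forall>m\<ge>N. \<forall>n\<ge>N. conn c (g \<otimes> u m) (g \<otimes> v n)" by blast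
qed

lemma same_end_ray:
  assumes t: "t \<in> carrier G" "\<chi> t > 0" and h: "h \<in> carrier G"
  shows "(\<lambda>n. h \<otimes> t [^] n) \<approx> (\<lambda>n. h \<otimes> t [^] n)"
  unfolding same_end_def
proof
  fix c
  obtain d where d: "conn d \<one> t" using conn_exists t by blast
  obtain N where N: "\<And>n. N \<le> n \<Longrightarrow> c - \<chi> h - d \<le> real n * \<chi> t"
    using large_multiple[OF t(2)] by blast
  have "conn c (h \<otimes> t [^] N) (h \<otimes> t [^] n)" if "N \<le> n" for n
    using N[of N] that by (intro conn_ray[OF d t h]) auto
  then have "conn c (h \<otimes> t [^] m) (h \<otimes> t [^] n)" if "N \<le> m" "N \<le> n" for m n
    using that half_conn_trans[OF half_conn_sym] by metis
  then show "\<exists>N::nat. \<forall>m\<ge>N. \<forall>n\<ge>N. conn c (h \<otimes> t [^] m) (h \<otimes> t [^] n)"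
    by blast
qed

lemma same_end_ray1:
  assumes "t \<in> carrier G" and "\<chi> t > 0"
  shows "(\<lambda>n. t [^] n) \<approx> (\<lambda>n. t [^] n)"
  using same_end_ray[OF assms, of \<one>] assms by simp

text \<open>Right multiplication by a fixed \<open>k\<close> moves every vertex of the ray along a path of bounded depth,
  which does not change the end.\<close>

lemma same_end_shift:
  assumes t: "t \<in> carrier G" "\<chi> t > 0" and h: "h \<in> carrier G" and k: "k \<in> carrier G"
  shows "(\<lambda>n. h \<otimes> t [^] n \<otimes> k) \<approx> (\<lambda>n. h \<otimes> t [^] n)"
  unfolding same_end_def
proof
  fix c
  obtain d where d: "conn d \<one> k" using conn_exists k by blast
  obtain N where N: "\<And>n. N \<le> n \<Longrightarrow> c - \<chi> h - d \<le> real n * \<chi> t"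
    using large_multiple[OF t(2)] by blast
  obtain N' :: nat
    where N': "\<And>m n. N' \<le> m \<Longrightarrow> N' \<le> n \<Longrightarrow> conn c (h \<otimes> t [^] m) (h \<otimes> t [^] n)"
    by (fact same_endE[OF same_end_ray[OF t h], where c = c])
  have "conn c (h \<otimes> t [^] m \<otimes> k) (h \<otimes> t [^] n)" if "max N N' \<le> m" "max N N' \<le> n" for m n :: nat
  proof -
    have "conn c ((h \<otimes> t [^] m) \<otimes> \<one>) ((h \<otimes> t [^] m) \<otimes> k)"
      using N[of m] that t h by (intro conn_translate[OF d]) auto
    then have "conn c (h \<otimes> t [^] m) (h \<otimes> t [^] m \<otimes> k)" using t h by simp
    then show ?thesis using half_conn_trans[OF half_conn_sym N'[of m n]] that by simp
  qed
  then show "\<exists>N::nat. \<forall>m\<ge>N. \<forall>n\<ge>N. conn c (h \<otimes> t [^] m \<otimes> k) (h \<otimes> t [^] n)" by blast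
qed

lemma subgroup_end_stab:
  assumes t: "t \<in> carrier G" "\<chi> t > 0"
  shows "subgroup (stab t) G"
proof (rule subgroupI)
  show "stab t \<subseteq> carrier G" by (auto simp: end_stab_def)
  have "\<one> \<in> stab t" using same_end_ray1[OF t] t by (simp add: end_stab_def)
  then show "stab t \<noteq> {}" by blast
next
  fix a assume a: "a \<in> stab t"
  then have aG: "a \<in> carrier G" by (simp add: end_stab_def)
  have "(\<lambda>n. inv a \<otimes> (a \<otimes> t [^] n)) \<approx> (\<lambda>n. inv a \<otimes> t [^] n)"
    using a aG by (intro same_end_translate) (auto simp: end_stab_def)
  then have "(\<lambda>n. t [^] n) \<approx> (\<lambda>n. inv a \<otimes> t [^] n)"
    using aG t by (simp flip: m_assoc)
  then show "inv a \<in> stab t" using aG same_end_sym by (simp add: end_stab_def)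
next
  fix a b assume a: "a \<in> stab t" and b: "b \<in> stab t"
  then have aG: "a \<in> carrier G" and bG: "b \<in> carrier G" by (auto simp: end_stab_def)
  have "(\<lambda>n. a \<otimes> (b \<otimes> t [^] n)) \<approx> (\<lambda>n. a \<otimes> t [^] n)"
    using b aG by (intro same_end_translate) (auto simp: end_stab_def)
  then have "(\<lambda>n. a \<otimes> b \<otimes> t [^] n) \<approx> (\<lambda>n. t [^] n)"
    using same_end_trans[of _ "\<lambda>n. a \<otimes> t [^] n"] a aG bG t by (simp add: m_assoc end_stab_def)
  then show "a \<otimes> b \<in> stab t" using aG bG by (simp add: end_stab_def)
qed

text \<open>A positive element of \<open>K\<^sub>t\<close> determines the same end as \<open>t\<close>.\<close>

lemma same_end_powers_of_stab:
  assumes t: "t \<in> carrier G" "\<chi> t > 0" and s: "s \<in> stab t" "\<chi> s > 0"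
  shows "(\<lambda>n. s [^] n) \<approx> (\<lambda>n. t [^] n)"
  unfolding same_end_def
proof
  fix c
  have sG: "s \<in> carrier G" using s by (simp add: end_stab_def)
  obtain d where d: "conn d \<one> t" using conn_exists t by blast
  obtain M where M: "\<And>m. M \<le> m \<Longrightarrow> c - d \<le> real m * \<chi> s"
    using large_multiple[OF s(2)] by blast
  obtain M' :: nat where M': "\<And>m n. M' \<le> m \<Longrightarrow> M' \<le> n \<Longrightarrow> conn c (s [^] m) (s [^] n)"
    by (fact same_endE[OF same_end_ray1[OF sG s(2)], where c = c])
  \<comment> \<open>The ray \<open>n \<mapsto> s\<^sup>p t\<^sup>n\<close> starts at \<open>s\<^sup>p\<close>, is connected at height \<open>c\<close>, and has the end of
    \<open>n \<mapsto> t\<^sup>n\<close>, since \<open>s\<^sup>p \<in> K\<^sub>t\<close>.\<close>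
  define p where "p = max M M'"
  have 1: "conn c (s [^] p) (s [^] p \<otimes> t [^] n)" for n :: nat
  proof -
    have "conn c (s [^] p \<otimes> t [^] (0::nat)) (s [^] p \<otimes> t [^] n)"
      by (rule conn_ray[OF d t]) (use M[of p] sG in \<open>auto simp: p_def\<close>)
    then show ?thesis using sG by simp
  qed
  interpret K: subgroup "stab t" G by (rule subgroup_end_stab[OF t])
  have "s [^] k \<in> stab t" for k :: nat
  proof (induction k)
    case 0
    show ?case using K.one_closed by simp
  next
    case (Suc k)
    then show ?case using K.m_closed[OF Suc s(1)] by simp
  qed
  from this[of p] have sp: "(\<lambda>n. s [^] p \<otimes> t [^] n) \<approx> (\<lambda>n. t [^] n)"
    unfolding end_stab_def by blast
  obtain N :: nat
    where N: "\<And>m n. N \<le> m \<Longrightarrow> N \<le> n \<Longrightarrow> conn c (s [^] p \<otimes> t [^] m) (t [^] n)"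
    by (fact same_endE[OF sp, where c = c])
  have "conn c (s [^] m) (t [^] n)" if "max p N \<le> m" "max p N \<le> n" for m n :: nat
  proof -
    have "conn c (s [^] m) (s [^] p)" using M'[of m p] that by (simp add: p_def)
    moreover have "conn c (s [^] p) (t [^] n)"
      using half_conn_trans[OF 1[of n] N[of n n]] that by simp
    ultimately show ?thesis by (rule half_conn_trans)
  qed
  then show "\<exists>N::nat. \<forall>m\<ge>N. \<forall>n\<ge>N. conn c (s [^] m) (t [^] n)" by blast
qed

lemma end_stab_eq:
  assumes t: "t \<in> carrier G" "\<chi> t > 0" and s: "s \<in> stab t" "\<chi> s > 0"
  shows "stab s = stab t"
proof -
  have st: "(\<lambda>n. s [^] n) \<approx> (\<lambda>n. t [^] n)" by (rule same_end_powers_of_stab[OF t s])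
  have "(\<lambda>n. h \<otimes> s [^] n) \<approx> (\<lambda>n. s [^] n) \<longleftrightarrow> (\<lambda>n. h \<otimes> t [^] n) \<approx> (\<lambda>n. t [^] n)"
    if "h \<in> carrier G" for h
  proof
    note hst = same_end_translate[OF st that]
    show "(\<lambda>n. h \<otimes> t [^] n) \<approx> (\<lambda>n. t [^] n)" if "(\<lambda>n. h \<otimes> s [^] n) \<approx> (\<lambda>n. s [^] n)"
      by (rule same_end_trans[OF same_end_sym[OF hst] same_end_trans[OF that st]])
    show "(\<lambda>n. h \<otimes> s [^] n) \<approx> (\<lambda>n. s [^] n)" if "(\<lambda>n. h \<otimes> t [^] n) \<approx> (\<lambda>n. t [^] n)"
      by (rule same_end_trans[OF hst same_end_trans[OF that same_end_sym[OF st]]])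
  qed
  then show ?thesis by (auto simp: end_stab_def)
qed

lemma end_stab_self:
  assumes "t \<in> carrier G" "\<chi> t > 0"
  shows "t \<in> stab t"
proof -
  have "(\<lambda>n. \<one> \<otimes> t [^] n \<otimes> t) \<approx> (\<lambda>n. \<one> \<otimes> t [^] n)"
    by (rule same_end_shift) (use assms in auto)
  then show ?thesis
    using assms by (simp add: end_stab_def nat_pow_Suc2[symmetric] del: nat_pow_Suc2)
qed

text \<open>The conjugate \<open>r = h s h\<^sup>-\<^sup>1\<close> is again a positive element of \<open>K\<^sub>t\<close>, so its powers have the end of
  \<open>n \<mapsto> s\<^sup>n\<close>. On the other hand \<open>r\<^sup>n = h s\<^sup>n h\<^sup>-\<^sup>1\<close> has the end of \<open>n \<mapsto> h s\<^sup>n\<close>.\<close>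

lemma end_stab_absorbs_pos:
  assumes t: "t \<in> carrier G" "\<chi> t > 0" and s: "s \<in> stab t" "\<chi> s > 0"
    and h: "h \<in> carrier G" "h \<otimes> s \<otimes> inv h \<in> stab t"
  shows "h \<in> stab t"
proof -
  let ?r = "h \<otimes> s \<otimes> inv h"
  have sG: "s \<in> carrier G" using s by (simp add: end_stab_def)
  have eq: "stab s = stab t" by (rule end_stab_eq[OF t s])
  have pow: "?r [^] n = h \<otimes> s [^] n \<otimes> inv h" for n :: nat
  proof (induction n)
    case 0
    then show ?case using h by simp
  next
    case (Suc n)
    have "(h \<otimes> s [^] n \<otimes> inv h) \<otimes> (h \<otimes> s \<otimes> inv h)
        = h \<otimes> s [^] n \<otimes> s \<otimes> inv h"
      using h(1) sG by (simp add: m_assoc inv_solve_left')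
    then show ?case using h(1) sG Suc by (simp add: m_assoc[of h])
  qed
  have "(\<lambda>n. ?r [^] n) \<approx> (\<lambda>n. s [^] n)"
    by (rule same_end_powers_of_stab[OF sG s(2)]) (use h s sG eq in auto)
  moreover have "(\<lambda>n. ?r [^] n) \<approx> (\<lambda>n. h \<otimes> s [^] n)"
    unfolding pow by (rule same_end_shift[OF sG s(2)]) (use h in auto)
  ultimately have "(\<lambda>n. h \<otimes> s [^] n) \<approx> (\<lambda>n. s [^] n)"
    using same_end_trans[OF same_end_sym] by blast
  then have "h \<in> stab s" using h(1) by (simp add: end_stab_def)
  then show ?thesis using eq by simp
qed

lemma end_stab_absorbs:
  assumes t: "t \<in> carrier G" "\<chi> t > 0" and s: "s \<in> stab t" "\<chi> s \<noteq> 0"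
    and h: "h \<in> carrier G" "h \<otimes> s \<otimes> inv h \<in> stab t"
  shows "h \<in> stab t"
proof (cases "\<chi> s > 0")
  case True
  then show ?thesis using end_stab_absorbs_pos[OF t s(1) _ h] by simp
next
  case False
  interpret K: subgroup "stab t" G by (rule subgroup_end_stab[OF t])
  have sG: "s \<in> carrier G" using s by simp
  have "h \<otimes> inv s \<otimes> inv h = inv (h \<otimes> s \<otimes> inv h)"
    using h(1) sG by (simp add: inv_mult_group m_assoc)
  then show ?thesis
    using end_stab_absorbs_pos[OF t, of "inv s" h] s h K.m_inv_closed False sG by simp
qed

lemma end_stab_commuting:
  assumes t: "t \<in> carrier G" "\<chi> t > 0" and s: "s \<in> stab t" "\<chi> s \<noteq> 0"
    and h: "h \<in> carrier G" "h \<otimes> s = s \<otimes> h"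
  shows "h \<in> stab t"
proof (rule end_stab_absorbs[OF t s h(1)])
  have "s \<in> carrier G" using s by (simp add: end_stab_def)
  then show "h \<otimes> s \<otimes> inv h \<in> stab t" using h s by (simp add: m_assoc)
qed

lemma end_stab_full_imp_connected:
  assumes t: "t \<in> carrier G" "\<chi> t > 0" and full: "stab t = carrier G" and "finite Y"
  shows "Digraph_Component.connected (cayley_graph G Y \<restriction> char_half G \<chi>)"
proof -
  have "finite_gen_set G Y" using assms gens generate_gens by (simp add: finite_gen_set_def)
  \<comment> \<open>The paths from \<open>\<one>\<close> to \<open>t\<close> may all go below height \<open>0\<close>; \<open>s\<close> replaces \<open>t\<close>.\<close>
  then obtain s where s: "s \<in> carrier G" "\<chi> s > 0" "conn 0 \<one> s"
    using character_positive_elem[OF char] by blast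
  have eq: "stab s = carrier G" using end_stab_eq[OF t _ s(2)] s full by simp
  have *: "conn 0 \<one> u" if "u \<in> carrier G" "\<chi> u \<ge> 0" for u
  proof -
    have "u \<in> stab s" using that eq by simp
    then obtain n :: nat where "conn 0 (u \<otimes> s [^] n) (s [^] n)"
      unfolding end_stab_def same_end_def by blast
    moreover have "conn 0 (u \<otimes> s [^] (0::nat)) (u \<otimes> s [^] n)"
      by (rule conn_ray[OF s(3,1,2) that(1)]) (use that in auto)
    moreover have "conn 0 (\<one> \<otimes> s [^] (0::nat)) (\<one> \<otimes> s [^] n)"
      by (rule conn_ray[OF s(3,1,2)]) auto
    ultimately have 1: "conn 0 u (u \<otimes> s [^] n)" "conn 0 (u \<otimes> s [^] n) (s [^] n)"
      "conn 0 \<one> (s [^] n)"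
      using that s(1) by auto
    show ?thesis by (rule half_conn_trans[OF 1(3) half_conn_sym[OF half_conn_trans[OF 1(1,2)]]])
  qed
  have "\<one> \<in> char_half G \<chi>" by (simp add: char_half_def)
  then have "char_half G \<chi> \<noteq> {}" by blast
  then show ?thesis
    by (subst connected_half_iff)
      (auto simp: char_half_def intro: half_conn_trans[OF half_conn_sym[OF *] *])
qed

lemma connected_imp_end_stab_full:
  assumes t: "t \<in> carrier G" "\<chi> t > 0"
    and con: "Digraph_Component.connected (cayley_graph G Y \<restriction> char_half G \<chi>)"
  shows "stab t = carrier G"
proof -
  have "\<one> \<in> char_half G \<chi>" by (simp add: char_half_def)
  then have "char_half G \<chi> \<noteq> {}" by blast
  then have con: "conn 0 u v" if "u \<in> carrier G" "v \<in> carrier G" "\<chi> u \<ge> 0" "\<chi> v \<ge> 0" for u v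
    using con that unfolding connected_half_iff[OF \<open>char_half G \<chi> \<noteq> {}\<close>] by (simp add: char_half_def)
  have "(\<lambda>n. h \<otimes> t [^] n) \<approx> (\<lambda>n. t [^] n)" if h: "h \<in> carrier G" for h
    unfolding same_end_def
  proof
    fix c
    obtain k where k: "\<And>n. k \<le> n \<Longrightarrow> c \<le> real n * \<chi> t"
      using large_multiple[OF t(2)] by blast
    obtain N where N: "\<And>n. N \<le> n \<Longrightarrow> real k * \<chi> t + \<bar>\<chi> h\<bar> \<le> real n * \<chi> t"
      using large_multiple[OF t(2)] by blast
    have "conn c (h \<otimes> t [^] m) (t [^] n)" if "N \<le> m" "N \<le> n" for m n :: nat
    proof -
      \<comment> \<open>Translation by \<open>t\<^sup>-\<^sup>k\<close> reduces height \<open>c\<close> to the given case of height \<open>0\<close>.\<close>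
      let ?i = "inv (t [^] k)"
      have "conn 0 (?i \<otimes> (h \<otimes> t [^] m)) (?i \<otimes> t [^] n)"
        using N[OF that(1)] N[OF that(2)] t(1) h by (intro con) auto
      then have "conn c (t [^] k \<otimes> (?i \<otimes> (h \<otimes> t [^] m))) (t [^] k \<otimes> (?i \<otimes> t [^] n))"
        by (rule conn_translate) (use k[of k] t in auto)
      then show ?thesis using t h by (simp flip: m_assoc)
    qed
    then show "\<exists>N::nat. \<forall>m\<ge>N. \<forall>n\<ge>N. conn c (h \<otimes> t [^] m) (t [^] n)" by blast
  qed
  then show ?thesis by (auto simp: end_stab_def)
qed

end

section \<open>Sigma invariants and homomorphisms\<close>

lemma char_class_eqI:
  assumes "0 < r" and "\<And>h. h \<in> carrier H \<Longrightarrow> \<chi> h = r * \<psi> h"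
  shows "char_class H \<chi> = char_class H \<psi>"
proof -
  have "(\<exists>q>0. \<forall>h\<in>carrier H. \<phi> h = q * \<chi> h) \<longleftrightarrow> (\<exists>q>0. \<forall>h\<in>carrier H. \<phi> h = q * \<psi> h)" for \<phi>
  proof
    assume "\<exists>q>0. \<forall>h\<in>carrier H. \<phi> h = q * \<chi> h"
    then obtain q where "q > 0" "\<forall>h\<in>carrier H. \<phi> h = q * \<chi> h" by blast
    then show "\<exists>q>0. \<forall>h\<in>carrier H. \<phi> h = q * \<psi> h"
      using assms by (intro exI[of _ "q * r"]) auto
  next
    assume "\<exists>q>0. \<forall>h\<in>carrier H. \<phi> h = q * \<psi> h"
    then obtain q where "q > 0" "\<forall>h\<in>carrier H. \<phi> h = q * \<psi> h" by blast
    then show "\<exists>q>0. \<forall>h\<in>carrier H. \<phi> h = q * \<chi> h"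
      using assms by (intro exI[of _ "q / r"]) auto
  qed
  then show ?thesis by (simp add: char_class_def)
qed

lemma char_class_eqD:
  assumes "is_character H \<chi>" and "char_class H \<chi> = char_class H \<psi>"
  obtains r where "0 < r" and "\<And>h. h \<in> carrier H \<Longrightarrow> \<chi> h = r * \<psi> h"
proof -
  have "\<chi> \<in> char_class H \<chi>"
    unfolding char_class_def by (auto intro!: exI[of _ 1] assms(1))
  then have "\<chi> \<in> char_class H \<psi>" by (simp only: assms(2))
  then have "\<exists>r>0. \<forall>h\<in>carrier H. \<chi> h = r * \<psi> h" by (simp add: char_class_def)
  then show thesis using that by blast
qed

text \<open>Membership in \<open>\<Sigma>\<^sup>1\<close> depends neither on the representative of the class nor on the finite
  generating set.\<close>

lemma (in group) Sigma1_iff: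
  assumes \<chi>: "is_character G \<chi>" and Y: "finite_gen_set G Y"
  shows "char_class G \<chi> \<in> Sigma1 G \<longleftrightarrow>
    Digraph_Component.connected (cayley_graph G Y \<restriction> char_half G \<chi>)"
proof
  assume "char_class G \<chi> \<in> Sigma1 G"
  then obtain \<psi> X where \<psi>: "char_class G \<chi> = char_class G \<psi>" "is_character G \<psi>"
    and X: "finite_gen_set G X" "Digraph_Component.connected (cayley_graph G X \<restriction> char_half G \<psi>)"
    unfolding Sigma1_def by blast
  obtain r where r: "0 < r" "\<And>h. h \<in> carrier G \<Longrightarrow> \<chi> h = r * \<psi> h"
    using char_class_eqD[OF \<chi> \<psi>(1)] by blast
  have "char_half G \<chi> = char_half G \<psi>"
    using r by (auto simp: char_half_def zero_le_mult_iff)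
  then show "Digraph_Component.connected (cayley_graph G Y \<restriction> char_half G \<chi>)"
    using connected_half_indep[OF \<chi> X(1) Y] X(2) by simp
qed (use assms in \<open>auto simp: Sigma1_def\<close>)

lemma (in character_group) Sigma1_iff_end_stab:
  assumes "t \<in> carrier G" and "\<chi> t > 0" and "finite Y"
  shows "char_class G \<chi> \<in> Sigma1 G \<longleftrightarrow> stab t = carrier G"
proof -
  have "finite_gen_set G Y" using assms gens generate_gens by (simp add: finite_gen_set_def)
  then show ?thesis
    using Sigma1_iff[OF char] end_stab_full_imp_connected connected_imp_end_stab_full assms by blast
qed

lemma half_conn_hom:
  assumes "p \<in> hom H Q" and "\<And>h. h \<in> carrier H \<Longrightarrow> \<chi> h = \<psi> (p h)"
    and "Y \<subseteq> carrier H" and "p ` Y \<subseteq> Z" and "half_conn H \<chi> Y c u v"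
  shows "half_conn Q \<psi> Z c (p u) (p v)"
  using assms(5) unfolding half_conn_def
proof (induction rule: rtrancl_on_induct)
  case base
  then show ?case using assms by (auto simp: hom_in_carrier)
next
  case (step y z)
  then have "\<exists>x\<in>Y. z = y \<otimes>\<^bsub>H\<^esub> x \<or> y = z \<otimes>\<^bsub>H\<^esub> x" by simp
  then obtain x where x: "x \<in> Y" "z = y \<otimes>\<^bsub>H\<^esub> x \<or> y = z \<otimes>\<^bsub>H\<^esub> x" by blast
  from x(2) have "p z = p y \<otimes>\<^bsub>Q\<^esub> p x \<or> p y = p z \<otimes>\<^bsub>Q\<^esub> p x"
  proof
    assume "z = y \<otimes>\<^bsub>H\<^esub> x"
    then have "p z = p y \<otimes>\<^bsub>Q\<^esub> p x" using step.hyps x(1) assms(1,3) by (auto intro: hom_mult)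
    then show ?thesis ..
  next
    assume "y = z \<otimes>\<^bsub>H\<^esub> x"
    then have "p y = p z \<otimes>\<^bsub>Q\<^esub> p x" using step.hyps x(1) assms(1,3) by (auto intro: hom_mult)
    then show ?thesis ..
  qed
  then have "(p y, p z) \<in> {(a, b). \<exists>x\<in>Z. b = a \<otimes>\<^bsub>Q\<^esub> x \<or> a = b \<otimes>\<^bsub>Q\<^esub> x}"
    using x assms(4) by blast
  then show ?case
    using step assms(1,2) by (intro rtrancl_on_into_rtrancl_on[OF step.IH]) (auto simp: hom_in_carrier)
qed

text \<open>A surjection \<open>p\<close> through which \<open>\<chi>\<close> factors maps the half of the Cayley graph where \<open>\<chi> \<ge> 0\<close>
  onto the vertices of the corresponding half for the image.\<close>

lemma Sigma1_image:
  assumes p: "group_hom H Q p" and surj: "p ` carrier H = carrier Q"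
    and \<chi>: "is_character H \<chi>" and \<psi>: "is_character Q \<psi>"
    and eq: "\<And>h. h \<in> carrier H \<Longrightarrow> \<chi> h = \<psi> (p h)"
    and fg: "finitely_generated H" and "char_class H \<chi> \<in> Sigma1 H"
  shows "char_class Q \<psi> \<in> Sigma1 Q"
proof -
  interpret p: group_hom H Q p by (rule p)
  obtain Y where Y: "finite_gen_set H Y" using fg by (auto simp: finitely_generated_def)
  then have YH: "Y \<subseteq> carrier H" by (simp add: finite_gen_set_def)
  have Z: "finite_gen_set Q (p ` Y)"
    using Y p.generate_img[OF YH] surj by (auto simp: finite_gen_set_def)
  have con: "Digraph_Component.connected (cayley_graph H Y \<restriction> char_half H \<chi>)"
    using p.G.Sigma1_iff[OF \<chi> Y] assms(7) by simp
  have "\<one>\<^bsub>H\<^esub> \<in> char_half H \<chi>" and "\<one>\<^bsub>Q\<^esub> \<in> char_half Q \<psi>"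
    using p.G.is_character_one[OF \<chi>] p.H.is_character_one[OF \<psi>] by (auto simp: char_half_def)
  then have ne: "char_half H \<chi> \<noteq> {}" "char_half Q \<psi> \<noteq> {}" by blast+
  have half: "char_half Q \<psi> = p ` char_half H \<chi>"
    unfolding char_half_def surj[symmetric] using eq by auto
  have "half_conn Q \<psi> (p ` Y) 0 (p u) (p v)" if "u \<in> char_half H \<chi>" "v \<in> char_half H \<chi>" for u v
    by (rule half_conn_hom[where \<chi> = \<chi>, OF p.homh _ YH order_refl])
      (use that eq con[unfolded connected_half_iff[OF ne(1)]] in auto)
  then have "Digraph_Component.connected (cayley_graph Q (p ` Y) \<restriction> char_half Q \<psi>)"
    unfolding connected_half_iff[OF ne(2)] unfolding half by simp
  then show ?thesis using p.H.Sigma1_iff[OF \<psi> Z] by simp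
qed

lemma end_stab_hom:
  assumes p: "group_hom H Q p" and eq: "\<And>h. h \<in> carrier H \<Longrightarrow> \<chi> h = \<psi> (p h)"
    and Y: "Y \<subseteq> carrier H" "p ` Y \<subseteq> Z" and t: "t \<in> carrier H"
    and g: "g \<in> end_stab H \<chi> Y t"
  shows "p g \<in> end_stab Q \<psi> Z (p t)"
proof -
  interpret p: group_hom H Q p by (rule p)
  have gH: "g \<in> carrier H" using g by (simp add: end_stab_def)
  have "\<exists>N::nat. \<forall>m\<ge>N. \<forall>n\<ge>N. half_conn Q \<psi> Z c (p (g \<otimes>\<^bsub>H\<^esub> t [^]\<^bsub>H\<^esub> m)) (p (t [^]\<^bsub>H\<^esub> n))" for c
  proof -
    obtain N :: nat where "\<forall>m\<ge>N. \<forall>n\<ge>N. half_conn H \<chi> Y c (g \<otimes>\<^bsub>H\<^esub> t [^]\<^bsub>H\<^esub> m) (t [^]\<^bsub>H\<^esub> n)"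
      using g unfolding end_stab_def same_end_def by blast
    then show ?thesis using half_conn_hom[where p = p and \<chi> = \<chi> and \<psi> = \<psi>, OF p.homh eq Y] by blast
  qed
  then show ?thesis
    using gH t by (simp add: end_stab_def same_end_def p.hom_nat_pow)
qed

lemma group_real_group: "group real_group"
proof (rule groupI)
  show "\<exists>y\<in>carrier real_group. y \<otimes>\<^bsub>real_group\<^esub> x = \<one>\<^bsub>real_group\<^esub>" for x
    by (intro bexI[of _ "- x"]) (auto simp: real_group_def)
qed (auto simp: real_group_def)

lemma is_character_compose:
  assumes "p \<in> hom H Q" and "is_character Q \<psi>" and "p ` carrier H = carrier Q"
  shows "is_character H (\<lambda>h. \<psi> (p h))"
proof -
  have "\<psi> \<circ> p \<in> hom H real_group"
    using assms(1,2) by (intro Group.hom_compose) (auto simp: is_character_def)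
  moreover have "\<exists>h\<in>carrier H. \<psi> (p h) \<noteq> 0"
    using assms(2) unfolding is_character_def assms(3)[symmetric] by blast
  ultimately show ?thesis by (simp add: is_character_def comp_def)
qed

section \<open>Groups generated by two elementwise commuting copies\<close>

context group
begin

lemma inv_cancel_left [simp]:
  "\<lbrakk>x \<in> carrier G; y \<in> carrier G\<rbrakk> \<Longrightarrow> inv x \<otimes> (x \<otimes> y) = y"
  "\<lbrakk>x \<in> carrier G; y \<in> carrier G\<rbrakk> \<Longrightarrow> x \<otimes> (inv x \<otimes> y) = y"
  by (simp_all flip: m_assoc)

text \<open>The convention is \<open>[x, y] = x y x\<^sup>-\<^sup>1 y\<^sup>-\<^sup>1\<close>.\<close>

definition commutator :: "'a \<Rightarrow> 'a \<Rightarrow> 'a" where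
  "commutator x y = x \<otimes> y \<otimes> inv x \<otimes> inv y"

lemma commutator_closed [simp]:
  "x \<in> carrier G \<Longrightarrow> y \<in> carrier G \<Longrightarrow> commutator x y \<in> carrier G"
  by (simp add: commutator_def)

lemma commutator_mult_left:
  assumes "x \<in> carrier G" and "y \<in> carrier G" and "z \<in> carrier G"
  shows "commutator (x \<otimes> y) z = x \<otimes> commutator y z \<otimes> inv x \<otimes> commutator x z"
  using assms by (simp add: commutator_def m_assoc inv_mult_group)

text \<open>Sidki's observation: if \<open>x\<close>, \<open>y\<close> and \<open>x y\<close> commute with \<open>x'\<close>, \<open>y'\<close> and \<open>x' y'\<close> respectively,
  then \<open>[x'\<^sup>-\<^sup>1, y] = [x\<^sup>-\<^sup>1, y']\<close>.\<close>

lemma commutator_swap_inv: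
  assumes G: "x \<in> carrier G" "x' \<in> carrier G" "y \<in> carrier G" "y' \<in> carrier G"
    and x: "x \<otimes> x' = x' \<otimes> x" and y: "y \<otimes> y' = y' \<otimes> y"
    and xy: "(x \<otimes> y) \<otimes> (x' \<otimes> y') = (x' \<otimes> y') \<otimes> (x \<otimes> y)"
  shows "commutator (inv x') y = commutator (inv x) y'"
proof -
  have 1: "y \<otimes> x' = inv x \<otimes> (x' \<otimes> (y' \<otimes> (x \<otimes> (y \<otimes> inv y'))))"
  proof -
    have "x \<otimes> ((y \<otimes> x') \<otimes> y') = (x' \<otimes> y') \<otimes> (x \<otimes> y)" using G xy by (simp add: m_assoc)
    then have "(y \<otimes> x') \<otimes> y' = inv x \<otimes> ((x' \<otimes> y') \<otimes> (x \<otimes> y))"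
      using G by (subst inv_solve_left) auto
    then have "y \<otimes> x' = (inv x \<otimes> ((x' \<otimes> y') \<otimes> (x \<otimes> y))) \<otimes> inv y'"
      using G by (subst inv_solve_right) auto
    then show ?thesis using G by (simp add: m_assoc)
  qed
  have 2: "inv x \<otimes> x' = x' \<otimes> inv x"
    using G x by (simp add: inv_solve_left' inv_solve_right m_assoc flip: x)
  have 3: "y \<otimes> inv y' = inv y' \<otimes> y"
    using G y by (simp add: inv_solve_right' m_assoc)
  have "commutator (inv x') y = inv x' \<otimes> ((y \<otimes> x') \<otimes> inv y)"
    using G by (simp add: commutator_def m_assoc)
  also have "\<dots> = inv x' \<otimes> ((inv x \<otimes> x') \<otimes> (y' \<otimes> (x \<otimes> ((y \<otimes> inv y') \<otimes> inv y))))"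
    unfolding 1 using G by (simp add: m_assoc)
  also have "\<dots> = commutator (inv x) y'"
    unfolding 2 3 using G by (simp add: commutator_def m_assoc)
  finally show ?thesis .
qed

lemma generate_conj:
  assumes "T \<subseteq> carrier G" and "x \<in> carrier G"
    and "\<And>t. t \<in> T \<Longrightarrow> x \<otimes> t \<otimes> inv x \<in> generate G T" and "h \<in> generate G T"
  shows "x \<otimes> h \<otimes> inv x \<in> generate G T"
  using assms(4)
proof induction
  case one
  then show ?case using assms(2) by (simp add: generate.one)
next
  case (incl h)
  then show ?case using assms(3) by simp
next
  case (inv h)
  then have "inv (x \<otimes> h \<otimes> inv x) \<in> generate G T"
    using generate_m_inv_closed[OF assms(1) assms(3)] by blast
  moreover have "h \<in> carrier G" using inv assms(1) by blast
  ultimately show ?case using assms(2) by (simp add: inv_mult_group m_assoc)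
next
  case (eng h k)
  then have "h \<in> carrier G" "k \<in> carrier G"
    using generate_in_carrier[OF assms(1)] by blast+
  then have "x \<otimes> (h \<otimes> k) \<otimes> inv x = (x \<otimes> h \<otimes> inv x) \<otimes> (x \<otimes> k \<otimes> inv x)"
    using assms(2) by (simp add: m_assoc)
  then show ?case using eng generate.eng by metis
qed

text \<open>The normalizer of \<open>N\<close>. The condition is imposed on both \<open>x\<close> and \<open>x\<^sup>-\<^sup>1\<close>, since the elements with
  \<open>x N x\<^sup>-\<^sup>1 \<subseteq> N\<close> need not form a subgroup when \<open>N\<close> is infinite.\<close>

lemma subgroup_normalizing:
  assumes "subgroup N G"
  shows "subgroup {x \<in> carrier G. \<forall>h\<in>N. x \<otimes> h \<otimes> inv x \<in> N \<and> inv x \<otimes> h \<otimes> x \<in> N} G"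
proof -
  interpret N: subgroup N G by (rule assms)
  have *: "(x \<otimes> y) \<otimes> h \<otimes> inv (x \<otimes> y) = x \<otimes> (y \<otimes> h \<otimes> inv y) \<otimes> inv x"
    "inv (x \<otimes> y) \<otimes> h \<otimes> (x \<otimes> y) = inv y \<otimes> (inv x \<otimes> h \<otimes> x) \<otimes> y"
    if "x \<in> carrier G" "y \<in> carrier G" "h \<in> N" for x y h
    using that by (simp_all add: inv_mult_group m_assoc)
  have "\<one> \<in> {x \<in> carrier G. \<forall>h\<in>N. x \<otimes> h \<otimes> inv x \<in> N \<and> inv x \<otimes> h \<otimes> x \<in> N}" by auto
  then show ?thesis
    by (intro subgroupI) (auto simp: * simp del: N.mem_carrier)
qed

end

text \<open>A group \<open>H\<close> generated by two homomorphic images of \<open>G\<close> such that the two images of each element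
  commute, in other words a quotient of the weak commutativity group of \<open>G\<close>. That the images
  generate \<open>H\<close> is expressed by saying that no proper subgroup contains both. In the comments below,
  \<open>g\<close> and \<open>g'\<close> stand for \<open>a g\<close> and \<open>b g\<close>.\<close>

locale commuting_copies = H: group H + G: group G
  for H :: "('c, 'd) monoid_scheme" (structure) and G :: "('a, 'b) monoid_scheme" +
  fixes a b :: "'a \<Rightarrow> 'c"
  assumes a_hom: "a \<in> hom G H" and b_hom: "b \<in> hom G H"
    and commute: "g \<in> carrier G \<Longrightarrow> a g \<otimes> b g = b g \<otimes> a g"
    and full: "\<lbrakk>subgroup K H; a ` carrier G \<subseteq> K; b ` carrier G \<subseteq> K\<rbrakk> \<Longrightarrow> K = carrier H"
begin

sublocale a: group_hom G H a
  by unfold_locales (rule a_hom)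

sublocale b: group_hom G H b
  by unfold_locales (rule b_hom)

lemma swapped: "commuting_copies H G b a"
  by unfold_locales (use a_hom b_hom commute full in auto)

text \<open>In the weak commutativity group, the elements \<open>l g\<close> are the generators of \<open>L(G)\<close>.\<close>

abbreviation l :: "'a \<Rightarrow> 'c" where
  "l g \<equiv> inv (b g) \<otimes> a g"

lemma commutator_swap:
  assumes g: "g \<in> carrier G" and h: "h \<in> carrier G"
  shows "H.commutator (b g) (a h) = H.commutator (a g) (b h)"
proof -
  let ?i = "inv\<^bsub>G\<^esub> g"
  have "H.commutator (inv (b ?i)) (a h) = H.commutator (inv (a ?i)) (b h)"
    using commute[of ?i] commute[OF h] commute[of "?i \<otimes>\<^bsub>G\<^esub> h"] g h
    by (intro H.commutator_swap_inv) auto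
  then show ?thesis using g by simp
qed

text \<open>By \<open>commutator_swap\<close>, \<open>[g h, k']\<close> is equal to \<open>[g' h', k]\<close>. Expanding both shows that \<open>g\<close>
  and \<open>g'\<close> act in the same way on \<open>[h, k']\<close>.\<close>

lemma conj_commutator:
  assumes g: "g \<in> carrier G" and h: "h \<in> carrier G" and k: "k \<in> carrier G"
  shows "a g \<otimes> H.commutator (a h) (b k) \<otimes> inv (a g) = b g \<otimes> H.commutator (a h) (b k) \<otimes> inv (b g)"
proof -
  have "H.commutator (a g \<otimes> a h) (b k) = H.commutator (b g \<otimes> b h) (a k)"
    using commutator_swap[of "g \<otimes>\<^bsub>G\<^esub> h" k] assms by simp
  then have "a g \<otimes> H.commutator (a h) (b k) \<otimes> inv (a g) \<otimes> H.commutator (a g) (b k)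
      = b g \<otimes> H.commutator (a h) (b k) \<otimes> inv (b g) \<otimes> H.commutator (a g) (b k)"
    using assms by (simp add: H.commutator_mult_left commutator_swap)
  then show ?thesis using assms by simp
qed

lemma l_commutes:
  assumes g: "g \<in> carrier G" and h: "h \<in> carrier G" and k: "k \<in> carrier G"
  shows "H.commutator (a h) (b k) \<otimes> l g = l g \<otimes> H.commutator (a h) (b k)"
proof -
  let ?d = "H.commutator (a h) (b k)"
  have d: "?d \<in> carrier H" using h k by simp
  have "a g \<otimes> ?d = b g \<otimes> ?d \<otimes> inv (b g) \<otimes> a g"
    using conj_commutator[OF assms] d g by (simp add: H.inv_solve_right')
  then have "inv (b g) \<otimes> (a g \<otimes> ?d) = inv (b g) \<otimes> (b g \<otimes> ?d \<otimes> inv (b g) \<otimes> a g)" by simp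
  then show ?thesis using d g by (simp add: H.m_assoc)
qed

lemma a_commutes_l:
  assumes g: "g \<in> carrier G"
  shows "a g \<otimes> l g = l g \<otimes> a g"
proof -
  have "b g \<otimes> (a g \<otimes> inv (b g)) = a g"
    using commute[OF g, symmetric] g by (simp flip: H.m_assoc) (simp add: H.m_assoc)
  then have "a g \<otimes> inv (b g) = inv (b g) \<otimes> a g" using g by (simp add: H.inv_solve_left)
  then show ?thesis using g by (simp flip: H.m_assoc)
qed

lemma normal_copiesI:
  assumes "T \<subseteq> carrier H"
    and "\<And>g t. g \<in> carrier G \<Longrightarrow> t \<in> T \<Longrightarrow> a g \<otimes> t \<otimes> inv (a g) \<in> generate H T"
    and "\<And>g t. g \<in> carrier G \<Longrightarrow> t \<in> T \<Longrightarrow> b g \<otimes> t \<otimes> inv (b g) \<in> generate H T"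
  shows "generate H T \<lhd> H"
proof -
  let ?N = "generate H T"
  let ?K = "{x \<in> carrier H. \<forall>h\<in>?N. x \<otimes> h \<otimes> inv x \<in> ?N \<and> inv x \<otimes> h \<otimes> x \<in> ?N}"
  have N: "subgroup ?N H" by (rule H.generate_is_subgroup[OF assms(1)])
  have a: "a g \<otimes> h \<otimes> inv (a g) \<in> ?N" if "g \<in> carrier G" "h \<in> ?N" for g h
    by (rule H.generate_conj[OF assms(1) _ assms(2)]) (use that in auto)
  have b: "b g \<otimes> h \<otimes> inv (b g) \<in> ?N" if "g \<in> carrier G" "h \<in> ?N" for g h
    by (rule H.generate_conj[OF assms(1) _ assms(3)]) (use that in auto)
  have "a g \<in> ?K" "b g \<in> ?K" if "g \<in> carrier G" for g
    using a[OF that] b[OF that] a[OF G.inv_closed[OF that]] b[OF G.inv_closed[OF that]] that by auto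
  then have "?K = carrier H" by (intro full H.subgroup_normalizing[OF N]) auto
  then show ?thesis unfolding H.normal_inv_iff using N by blast
qed

text \<open>With \<open>l g = g'\<^sup>-\<^sup>1 g\<close>, conjugation by \<open>k'\<close> preserves the generated subgroup because
  \<open>k' (l g) k'\<^sup>-\<^sup>1 = l (g k\<^sup>-\<^sup>1) (l (k\<^sup>-\<^sup>1))\<^sup>-\<^sup>1\<close>, and conjugation by \<open>k\<close> because \<open>k = k' (l k)\<close>.\<close>

lemma normal_generate_l: "generate H {l g | g. g \<in> carrier G} \<lhd> H"
proof (rule normal_copiesI)
  let ?T = "{l g | g. g \<in> carrier G}"
  show T: "?T \<subseteq> carrier H" by auto
  interpret N: subgroup "generate H ?T" H by (rule H.generate_is_subgroup[OF T])
  have l: "l g \<in> generate H ?T" if "g \<in> carrier G" for g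
    by (rule generate.incl) (use that in blast)
  have b: "b k \<otimes> l g \<otimes> inv (b k) \<in> generate H ?T" if g: "g \<in> carrier G" and k: "k \<in> carrier G" for g k
  proof -
    let ?i = "inv\<^bsub>G\<^esub> k"
    have "l (g \<otimes>\<^bsub>G\<^esub> ?i) \<otimes> inv (l ?i) \<in> generate H ?T"
      using g k by (intro N.m_closed[OF l N.m_inv_closed[OF l]]) auto
    moreover have "l (g \<otimes>\<^bsub>G\<^esub> ?i) \<otimes> inv (l ?i) = b k \<otimes> l g \<otimes> inv (b k)"
      using g k by (simp add: H.inv_mult_group H.m_assoc)
    ultimately show ?thesis by simp
  qed
  then show "b k \<otimes> t \<otimes> inv (b k) \<in> generate H ?T" if "k \<in> carrier G" "t \<in> ?T" for k t
    using that by blast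
  show "a k \<otimes> t \<otimes> inv (a k) \<in> generate H ?T" if k: "k \<in> carrier G" and t: "t \<in> ?T" for k t
  proof -
    have tH: "t \<in> carrier H" using t T by blast
    have tN: "t \<in> generate H ?T" by (rule generate.incl) (rule t)
    have lt: "l k \<otimes> t \<otimes> inv (l k) \<in> generate H ?T"
      by (rule N.m_closed[OF N.m_closed[OF l[OF k] tN] N.m_inv_closed[OF l[OF k]]])
    have "b k \<otimes> (l k \<otimes> t \<otimes> inv (l k)) \<otimes> inv (b k) \<in> generate H ?T"
      by (rule H.generate_conj[OF T _ _ lt]) (use b k in auto)
    moreover have "b k \<otimes> (l k \<otimes> t \<otimes> inv (l k)) \<otimes> inv (b k) = a k \<otimes> t \<otimes> inv (a k)"
      using k tH by (simp add: H.inv_mult_group H.m_assoc)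
    ultimately show ?thesis by simp
  qed
qed

lemma normal_commutator_subgroup:
  "commutator_subgroup H (a ` carrier G) (b ` carrier G) \<lhd> H"
proof -
  let ?T = "{H.commutator (a h) (b k) | h k. h \<in> carrier G \<and> k \<in> carrier G}"
  have T: "?T \<subseteq> carrier H" by auto
  interpret N: subgroup "generate H ?T" H by (rule H.generate_is_subgroup[OF T])
  have c: "H.commutator (a h) (b k) \<in> generate H ?T" if "h \<in> carrier G" "k \<in> carrier G" for h k
    by (rule generate.incl) (use that in blast)
  have "generate H ?T \<lhd> H"
  proof (rule normal_copiesI[OF T])
    fix g t assume g: "g \<in> carrier G" and "t \<in> ?T"
    then obtain h k where t: "t = H.commutator (a h) (b k)" "h \<in> carrier G" "k \<in> carrier G" by blast
    have "H.commutator (a (g \<otimes>\<^bsub>G\<^esub> h)) (b k) \<otimes> inv (H.commutator (a g) (b k)) \<in> generate H ?T"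
      using g t by (intro N.m_closed[OF c N.m_inv_closed[OF c]]) auto
    then show a: "a g \<otimes> t \<otimes> inv (a g) \<in> generate H ?T"
      using g t by (simp add: H.commutator_mult_left H.m_assoc)
    then show "b g \<otimes> t \<otimes> inv (b g) \<in> generate H ?T"
      using conj_commutator g t by simp
  qed
  moreover have "commutator_subgroup H (a ` carrier G) (b ` carrier G) = generate H ?T"
    unfolding commutator_subgroup_def H.commutator_def
    by (rule arg_cong[where f = "generate H"]) blast
  ultimately show ?thesis by simp
qed

lemma homs_eq:
  assumes f: "f \<in> hom H K" and f': "f' \<in> hom H K" and K: "group K"
    and "\<And>g. g \<in> carrier G \<Longrightarrow> f (a g) = f' (a g)"
    and "\<And>g. g \<in> carrier G \<Longrightarrow> f (b g) = f' (b g)" and "x \<in> carrier H"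
  shows "f x = f' x"
proof -
  interpret f: group_hom H K f
    using f K by (simp add: group_hom_def group_hom_axioms_def H.is_group)
  interpret f': group_hom H K f'
    using f' K by (simp add: group_hom_def group_hom_axioms_def H.is_group)
  have "subgroup {x \<in> carrier H. f x = f' x} H"
    by (rule H.subgroupI) (auto intro: exI[of _ "\<one>"])
  then have "{x \<in> carrier H. f x = f' x} = carrier H"
    using assms by (intro full) auto
  then show ?thesis using assms by blast
qed

lemma generate_copies:
  assumes "X \<subseteq> carrier G" and "generate G X = carrier G"
  shows "generate H (a ` X \<union> b ` X) = carrier H"
proof (rule full)
  have sub: "a ` X \<union> b ` X \<subseteq> carrier H" using assms(1) by auto
  then show "subgroup (generate H (a ` X \<union> b ` X)) H" by (rule H.generate_is_subgroup)
  show "a ` carrier G \<subseteq> generate H (a ` X \<union> b ` X)"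
    using a.generate_img[OF assms(1)] assms(2) H.mono_generate[of "a ` X" "a ` X \<union> b ` X"] by auto
  show "b ` carrier G \<subseteq> generate H (a ` X \<union> b ` X)"
    using b.generate_img[OF assms(1)] assms(2) H.mono_generate[of "b ` X" "a ` X \<union> b ` X"] by auto
qed

lemma finite_gen_set_copies:
  assumes "finite_gen_set G X"
  shows "finite_gen_set H (a ` X \<union> b ` X)"
  using assms generate_copies[of X] unfolding finite_gen_set_def by auto

lemma finitely_generated_copies: "finitely_generated G \<Longrightarrow> finitely_generated H"
  using finite_gen_set_copies unfolding finitely_generated_def by blast

end

text \<open>A character of such a group, with a finite generating set \<open>X\<close> of \<open>G\<close>; the two copies of \<open>X\<close>
  together serve as generating set of \<open>H\<close>. In the comments below, \<open>\<chi>\<^sub>1\<close> and \<open>\<chi>\<^sub>2\<close> are the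
  compositions of \<open>\<chi>\<close> with \<open>a\<close> and \<open>b\<close>.\<close>

locale commuting_copies_char = commuting_copies H G a b
  for H :: "('c, 'd) monoid_scheme" (structure) and G :: "('a, 'b) monoid_scheme" and a b +
  fixes \<chi> :: "'c \<Rightarrow> real" and X :: "'a set"
  assumes char_H: "is_character H \<chi>" and X: "finite_gen_set G X"
begin

sublocale C: character_group H \<chi> "a ` X \<union> b ` X"
  using char_H finite_gen_set_copies[OF X]
  by unfold_locales (auto simp: finite_gen_set_def)

lemma finite_copies: "finite (a ` X \<union> b ` X)"
  using X by (simp add: finite_gen_set_def)

lemma char_copies_hom:
  "(\<lambda>g. \<chi> (a g)) \<in> hom G real_group" "(\<lambda>g. \<chi> (b g)) \<in> hom G real_group"
  by (auto simp: hom_def real_group_def)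

lemma char_nontrivial:
  obtains g where "g \<in> carrier G" and "\<chi> (a g) \<noteq> 0 \<or> \<chi> (b g) \<noteq> 0"
proof -
  have "\<exists>g\<in>carrier G. \<chi> (a g) \<noteq> 0 \<or> \<chi> (b g) \<noteq> 0"
  proof (rule ccontr)
    assume *: "\<not> ?thesis"
    have zero: "(\<lambda>_. 0) \<in> hom H real_group" by (auto simp: hom_def real_group_def)
    have "\<chi> x = 0" if "x \<in> carrier H" for x
      by (rule homs_eq[OF _ zero group_real_group]) (use char_H * that in \<open>auto simp: is_character_def\<close>)
    then show False using char_H by (auto simp: is_character_def)
  qed
  then show thesis using that by blast
qed

text \<open>If \<open>[\<chi>\<^sub>1] \<in> \<Sigma>\<^sup>1(G)\<close>, then every element of \<open>G\<close> fixes the end of the powers of \<open>t\<close> in \<open>G\<close>, and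
  its first copy fixes the image of this end in \<open>H\<close>.\<close>

lemma first_stab:
  assumes t: "t \<in> carrier G" "\<chi> (a t) > 0" and "char_class G (\<lambda>g. \<chi> (a g)) \<in> Sigma1 G"
    and g: "g \<in> carrier G"
  shows "a g \<in> C.stab (a t)"
proof -
  have "is_character G (\<lambda>g. \<chi> (a g))"
    using t char_copies_hom(1) unfolding is_character_def by (intro conjI bexI[of _ t]) auto
  then interpret D: character_group G "\<lambda>g. \<chi> (a g)" X
    using X by unfold_locales (auto simp: finite_gen_set_def)
  have "finite X" using X by (simp add: finite_gen_set_def)
  then have "g \<in> end_stab G (\<lambda>g. \<chi> (a g)) X t"
    using D.Sigma1_iff_end_stab t assms(3) g by simp
  then show ?thesis
    by (intro end_stab_hom[where \<chi> = "\<lambda>g. \<chi> (a g)", OF a.group_hom_axioms _ D.gens _ t(1)]) auto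
qed

lemma Sigma1_two_distinct:
  assumes "\<exists>g\<in>carrier G. \<chi> (a g) \<noteq> 0" and "\<exists>g\<in>carrier G. \<chi> (b g) \<noteq> 0"
    and "\<exists>g\<in>carrier G. \<chi> (a g) \<noteq> \<chi> (b g)"
  shows "char_class H \<chi> \<in> Sigma1 H"
proof -
  obtain g where g: "g \<in> carrier G" "\<chi> (a g) \<noteq> 0" "\<chi> (a g) \<noteq> \<chi> (b g)"
  proof -
    obtain g1 g2 where g12: "g1 \<in> carrier G" "\<chi> (a g1) \<noteq> 0"
      "g2 \<in> carrier G" "\<chi> (a g2) \<noteq> \<chi> (b g2)"
      using assms by blast
    \<comment> \<open>A group is not the union of the two proper subgroups \<open>ker \<chi>\<^sub>1\<close> and
      \<open>ker (\<chi>\<^sub>1 - \<chi>\<^sub>2)\<close>.\<close>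
    consider "\<chi> (a g1) \<noteq> \<chi> (b g1)" | "\<chi> (a g2) \<noteq> 0"
      | "\<chi> (a g1) = \<chi> (b g1)" "\<chi> (a g2) = 0" by blast
    then show thesis
    proof cases
      case 3
      then show thesis using g12 that[of "g1 \<otimes>\<^bsub>G\<^esub> g2"] by simp
    qed (use g12 that in blast)+
  qed
  obtain h where h: "h \<in> carrier G" "\<chi> (b h) \<noteq> 0" using assms by blast
  have lH: "l g \<in> carrier H" using g(1) by simp
  have lg: "\<chi> (l g) \<noteq> 0" using g by simp
  obtain t where t: "t \<in> carrier H" "\<chi> t > 0" and lt: "l g = t \<or> l g = inv t"
  proof (cases "\<chi> (l g) > 0")
    case True
    then show thesis using that[of "l g"] lH by blast
  next
    case False
    then have "\<chi> (inv (l g)) > 0" using lg H.is_character_inv[OF char_H lH] by linarith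
    then show thesis using that[of "inv (l g)"] lH H.inv_inv[OF lH] by simp
  qed
  interpret K: subgroup "C.stab t" H by (rule C.subgroup_end_stab[OF t])
  have lK: "l g \<in> C.stab t"
    using lt C.end_stab_self[OF t] K.m_inv_closed[OF C.end_stab_self[OF t]] by (elim disjE) simp_all
  \<comment> \<open>By the closure properties of \<open>K\<^sub>t\<close>, it contains \<open>g\<close> and the commutators, then all of the
    second copy and finally all of the first.\<close>
  have aK: "a g \<in> C.stab t"
    by (rule C.end_stab_commuting[OF t lK lg]) (use g(1) a_commutes_l[OF g(1)] in simp_all)
  have cK: "H.commutator (a x) (b y) \<in> C.stab t" if "x \<in> carrier G" "y \<in> carrier G" for x y
    by (rule C.end_stab_commuting[OF t lK lg]) (use that l_commutes[OF g(1) that] in simp_all)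
  have bK: "b k \<in> C.stab t" if k: "k \<in> carrier G" for k
  proof (rule C.end_stab_absorbs[OF t aK g(2)])
    have "H.commutator (a k) (b g) \<otimes> a g \<in> C.stab t" using cK[OF k g(1)] aK by (rule K.m_closed)
    moreover have "H.commutator (a k) (b g) \<otimes> a g = b k \<otimes> a g \<otimes> inv (b k)"
      unfolding commutator_swap[OF k g(1), symmetric]
      using k g(1) by (simp add: H.commutator_def H.m_assoc)
    ultimately show "b k \<otimes> a g \<otimes> inv (b k) \<in> C.stab t" by simp
  qed (use k in auto)
  have "a k \<in> C.stab t" if k: "k \<in> carrier G" for k
  proof (rule C.end_stab_absorbs[OF t bK[OF h(1)] h(2)])
    have "H.commutator (a k) (b h) \<otimes> b h \<in> C.stab t"
      using cK[OF k h(1)] bK[OF h(1)] by (rule K.m_closed)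
    then show "a k \<otimes> b h \<otimes> inv (a k) \<in> C.stab t"
      using k h(1) by (simp add: H.commutator_def H.m_assoc)
  qed (use k in auto)
  then have "C.stab t = carrier H" using bK by (intro full[OF K.subgroup_axioms]) auto
  then show ?thesis using C.Sigma1_iff_end_stab[OF t finite_copies] by simp
qed

lemma Sigma1_second_trivial:
  assumes zero: "\<forall>g\<in>carrier G. \<chi> (b g) = 0" and S: "char_class G (\<lambda>g. \<chi> (a g)) \<in> Sigma1 G"
  shows "char_class H \<chi> \<in> Sigma1 H"
proof -
  obtain t where t: "t \<in> carrier G" "\<chi> (a t) > 0"
  proof -
    obtain g where "g \<in> carrier G" "\<chi> (a g) \<noteq> 0" using char_nontrivial zero by blast
    then show thesis using that[of g] that[of "inv\<^bsub>G\<^esub> g"] by (cases "\<chi> (a g) > 0") auto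
  qed
  have at: "a t \<in> carrier H" using t by simp
  interpret K: subgroup "C.stab (a t)" H by (rule C.subgroup_end_stab[OF at t(2)])
  note aK = first_stab[OF t S]
  have bK: "b g \<in> C.stab (a t)" if g: "g \<in> carrier G" "\<chi> (a g) \<noteq> 0" for g
    by (rule C.end_stab_commuting[OF at t(2) aK[OF g(1)] g(2)]) (use g commute in auto)
  have "b g \<in> C.stab (a t)" if g: "g \<in> carrier G" for g
  proof (cases "\<chi> (a g) = 0")
    case True
    \<comment> \<open>Now \<open>\<chi>\<^sub>1\<close> is non-zero at both \<open>g t\<close> and \<open>t\<close>.\<close>
    have "b (g \<otimes>\<^bsub>G\<^esub> t) \<otimes> inv (b t) \<in> C.stab (a t)"
      using True g t by (intro K.m_closed K.m_inv_closed bK) auto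
    then show ?thesis using g t(1) by (simp add: H.m_assoc)
  qed (use bK g in blast)
  then have "C.stab (a t) = carrier H" using aK by (intro full[OF K.subgroup_axioms]) auto
  then show ?thesis using C.Sigma1_iff_end_stab[OF at t(2) finite_copies] by simp
qed

end

lemma (in commuting_copies_char) swapped_char: "commuting_copies_char H G b a \<chi> X"
  using swapped char_H X
  by (simp add: commuting_copies_char_def commuting_copies_char_axioms_def)

context commuting_copies_char
begin

lemma Sigma1_first_trivial:
  assumes "\<forall>g\<in>carrier G. \<chi> (a g) = 0" and "char_class G (\<lambda>g. \<chi> (b g)) \<in> Sigma1 G"
  shows "char_class H \<chi> \<in> Sigma1 H"
  by (rule commuting_copies_char.Sigma1_second_trivial[OF swapped_char assms])

lemma Sigma1_equal:
  assumes eq: "\<forall>g\<in>carrier G. \<chi> (a g) = \<chi> (b g)" and S: "char_class G (\<lambda>g. \<chi> (a g)) \<in> Sigma1 G"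
  shows "char_class H \<chi> \<in> Sigma1 H"
proof -
  obtain t where t: "t \<in> carrier G" "\<chi> (a t) > 0"
  proof -
    obtain g where "g \<in> carrier G" "\<chi> (a g) \<noteq> 0" using char_nontrivial eq by metis
    then show thesis using that[of g] that[of "inv\<^bsub>G\<^esub> g"] by (cases "\<chi> (a g) > 0") auto
  qed
  have at: "a t \<in> carrier H" and bt: "\<chi> (b t) > 0" using t eq by auto
  interpret K: subgroup "C.stab (a t)" H by (rule C.subgroup_end_stab[OF at t(2)])
  have "char_class G (\<lambda>g. \<chi> (b g)) = char_class G (\<lambda>g. \<chi> (a g))"
    by (rule char_class_eqI[where r = 1]) (use eq in auto)
  then have bK: "b g \<in> end_stab H \<chi> (b ` X \<union> a ` X) (b t)" if "g \<in> carrier G" for g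
    using commuting_copies_char.first_stab[OF swapped_char t(1) bt] S that by simp
  have "b t \<in> C.stab (a t)"
    by (rule C.end_stab_commuting[OF at t(2) C.end_stab_self[OF at t(2)]]) (use t commute in auto)
  then have "C.stab (b t) = C.stab (a t)"
    by (rule C.end_stab_eq[OF at t(2) _ bt])
  then have "C.stab (a t) = carrier H"
    using bK first_stab[OF t S] by (intro full[OF K.subgroup_axioms]) (auto simp: Un_commute)
  then show ?thesis using C.Sigma1_iff_end_stab[OF at t(2) finite_copies] by simp
qed

end

text \<open>Two commuting copies together with the three retractions of \<open>H\<close> onto \<open>G\<close>. Both the weak
  commutativity group and its quotient by \<open>W(G)\<close> are of this kind.\<close>

locale retractable_copies = commuting_copies H G a b
  for H :: "('c, 'd) monoid_scheme" (structure) and G :: "('a, 'b) monoid_scheme" and a b +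
  assumes retract_first: "\<exists>p\<in>hom H G. \<forall>g\<in>carrier G. p (a g) = g \<and> p (b g) = \<one>\<^bsub>G\<^esub>"
    and retract_second: "\<exists>p\<in>hom H G. \<forall>g\<in>carrier G. p (a g) = \<one>\<^bsub>G\<^esub> \<and> p (b g) = g"
    and retract_both: "\<exists>p\<in>hom H G. \<forall>g\<in>carrier G. p (a g) = g \<and> p (b g) = g"
begin

lemma Sigma1_retract:
  assumes fg: "finitely_generated G" and \<chi>: "is_character H \<chi>" and S: "char_class H \<chi> \<in> Sigma1 H"
    and p: "p \<in> hom H G" and onto: "carrier G \<subseteq> p ` carrier H"
    and \<psi>: "\<psi> \<in> hom G real_group"
    and eq: "\<And>g. g \<in> carrier G \<Longrightarrow> \<psi> (p (a g)) = \<chi> (a g)" "\<And>g. g \<in> carrier G \<Longrightarrow> \<psi> (p (b g)) = \<chi> (b g)"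
  shows "char_class G \<psi> \<in> Sigma1 G"
proof -
  interpret p: group_hom H G p by unfold_locales (rule p)
  have \<chi>h: "\<chi> \<in> hom H real_group" using \<chi> by (simp add: is_character_def)
  have \<psi>p: "\<psi> \<circ> p \<in> hom H real_group" by (rule Group.hom_compose[OF p \<psi>])
  have *: "\<chi> x = \<psi> (p x)" if "x \<in> carrier H" for x
    using homs_eq[OF \<chi>h \<psi>p group_real_group _ _ that] eq by simp
  then have "is_character G \<psi>"
    using \<chi> \<psi> p.hom_closed unfolding is_character_def by metis
  moreover have "p ` carrier H = carrier G" using onto by auto
  ultimately show ?thesis
    using Sigma1_image[OF p.group_hom_axioms _ \<chi> _ * finitely_generated_copies[OF fg] S] by blast
qed

theorem Sigma1_iff_copies:
  assumes fg: "finitely_generated G" and \<chi>: "is_character H \<chi>"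
  shows "char_class H \<chi> \<in> Sigma1 H \<longleftrightarrow>
    (\<exists>g\<in>carrier G. \<chi> (a g) \<noteq> 0) \<and> (\<exists>g\<in>carrier G. \<chi> (b g) \<noteq> 0) \<and>
      (\<exists>g\<in>carrier G. \<chi> (a g) \<noteq> \<chi> (b g)) \<or>
    (\<forall>g\<in>carrier G. \<chi> (a g) = 0) \<and> char_class G (\<lambda>g. \<chi> (b g)) \<in> Sigma1 G \<or>
    (\<forall>g\<in>carrier G. \<chi> (b g) = 0) \<and> char_class G (\<lambda>g. \<chi> (a g)) \<in> Sigma1 G \<or>
    (\<forall>g\<in>carrier G. \<chi> (a g) = \<chi> (b g)) \<and> (\<exists>g\<in>carrier G. \<chi> (a g) \<noteq> 0) \<and>
      char_class G (\<lambda>g. \<chi> (a g)) \<in> Sigma1 G" (is "?S \<longleftrightarrow> ?R")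
proof -
  obtain X where "finite_gen_set G X" using fg by (auto simp: finitely_generated_def)
  then interpret commuting_copies_char H G a b \<chi> X by unfold_locales (use \<chi> in auto)
  have one: "\<chi> (a \<one>\<^bsub>G\<^esub>) = 0" "\<chi> (b \<one>\<^bsub>G\<^esub>) = 0" by simp_all
  have first: "char_class G (\<lambda>g. \<chi> (a g)) \<in> Sigma1 G" if S: ?S and "\<forall>g\<in>carrier G. \<chi> (b g) = 0"
  proof -
    obtain p where p: "p \<in> hom H G" "\<forall>g\<in>carrier G. p (a g) = g \<and> p (b g) = \<one>\<^bsub>G\<^esub>"
      using retract_first by blast
    have "g \<in> p ` carrier H" if "g \<in> carrier G" for g
      using p(2) that imageI[OF a.hom_closed[OF that], of p] by simp
    then have "carrier G \<subseteq> p ` carrier H" by blast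
    then show ?thesis
      using that p one by (intro Sigma1_retract[OF fg \<chi> S p(1) _ char_copies_hom(1)]) auto
  qed
  have second: "char_class G (\<lambda>g. \<chi> (b g)) \<in> Sigma1 G" if S: ?S and "\<forall>g\<in>carrier G. \<chi> (a g) = 0"
  proof -
    obtain p where p: "p \<in> hom H G" "\<forall>g\<in>carrier G. p (a g) = \<one>\<^bsub>G\<^esub> \<and> p (b g) = g"
      using retract_second by blast
    have "g \<in> p ` carrier H" if "g \<in> carrier G" for g
      using p(2) that imageI[OF b.hom_closed[OF that], of p] by simp
    then have "carrier G \<subseteq> p ` carrier H" by blast
    then show ?thesis
      using that p one by (intro Sigma1_retract[OF fg \<chi> S p(1) _ char_copies_hom(2)]) auto
  qed
  have both: "char_class G (\<lambda>g. \<chi> (a g)) \<in> Sigma1 G"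
    if S: ?S and "\<forall>g\<in>carrier G. \<chi> (a g) = \<chi> (b g)"
  proof -
    obtain p where p: "p \<in> hom H G" "\<forall>g\<in>carrier G. p (a g) = g \<and> p (b g) = g"
      using retract_both by blast
    have "g \<in> p ` carrier H" if "g \<in> carrier G" for g
      using p(2) that imageI[OF a.hom_closed[OF that], of p] by simp
    then have "carrier G \<subseteq> p ` carrier H" by blast
    then show ?thesis
      using that p by (intro Sigma1_retract[OF fg \<chi> S p(1) _ char_copies_hom(1)]) auto
  qed
  show ?thesis
  proof
    assume S: ?S
    show ?R
    proof (cases "(\<forall>g\<in>carrier G. \<chi> (a g) = 0) \<or> (\<forall>g\<in>carrier G. \<chi> (b g) = 0)")
      case True
      then show ?thesis using first[OF S] second[OF S] by blast
    next
      case False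
      then show ?thesis using both[OF S] by blast
    qed
  next
    assume ?R
    then show ?S
      by (elim disjE conjE)
        (rule Sigma1_two_distinct Sigma1_first_trivial Sigma1_second_trivial Sigma1_equal; assumption)+
  qed
qed

end

section \<open>The weak commutativity construction\<close>

text \<open>The value in \<open>K\<close> of a word, given the values \<open>f\<close> of the letters.\<close>

definition eval_word :: "('c, 'd) monoid_scheme \<Rightarrow> ('s \<Rightarrow> 'c) \<Rightarrow> 's list \<Rightarrow> 'c" where
  "eval_word K f w = foldr (\<lambda>s x. f s \<otimes>\<^bsub>K\<^esub> x) w \<one>\<^bsub>K\<^esub>"

lemma eval_word_simps [simp]:
  "eval_word K f [] = \<one>\<^bsub>K\<^esub>"
  "eval_word K f (s # w) = f s \<otimes>\<^bsub>K\<^esub> eval_word K f w"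
  by (simp_all add: eval_word_def)

lemma presented_universal:
  assumes K: "monoid K" and f: "\<And>s. s \<in> S \<Longrightarrow> f s \<in> carrier K"
    and R: "\<And>u v. (u, v) \<in> R \<Longrightarrow> u \<in> lists S \<Longrightarrow> v \<in> lists S \<Longrightarrow> eval_word K f u = eval_word K f v"
  obtains \<phi> where "\<phi> \<in> hom (presented S R) K"
    and "\<And>w. w \<in> lists S \<Longrightarrow> \<phi> (word_cong S R `` {w}) = eval_word K f w"
proof -
  interpret monoid K by (rule K)
  have closed: "eval_word K f w \<in> carrier K" if "w \<in> lists S" for w
    using that f by (induction w) auto
  have append: "eval_word K f (u @ v) = eval_word K f u \<otimes>\<^bsub>K\<^esub> eval_word K f v"
    if "u \<in> lists S" "v \<in> lists S" for u v
    using that(1) by (induction u) (use that f closed in \<open>auto simp: m_assoc\<close>)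
  have cong: "eval_word K f u = eval_word K f v" if "(u, v) \<in> word_cong S R" for u v
    using that
  proof induction
    case (wc_append u v u' v')
    then show ?case using append word_cong_lists[OF wc_append.hyps(1)] word_cong_lists[OF wc_append.hyps(2)]
      by simp
  qed (use R in auto)
  define \<phi> where "\<phi> A = eval_word K f (SOME w. w \<in> A)" for A
  have \<phi>: "\<phi> (word_cong S R `` {w}) = eval_word K f w" if "w \<in> lists S" for w
  proof -
    have "w \<in> word_cong S R `` {w}" using that by (simp add: wc_refl)
    then have "(SOME w'. w' \<in> word_cong S R `` {w}) \<in> word_cong S R `` {w}" by (rule someI)
    then have "(w, SOME w'. w' \<in> word_cong S R `` {w}) \<in> word_cong S R" by blast
    from cong[OF this] show ?thesis by (simp only: \<phi>_def)
  qed
  have "\<phi> \<in> hom (presented S R) K"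
  proof (rule homI)
    fix x assume "x \<in> carrier (presented S R)"
    then obtain u where u: "u \<in> lists S" "x = word_cong S R `` {u}"
      unfolding carrier_presented by blast
    then show "\<phi> x \<in> carrier K" using \<phi>[OF u(1)] closed[OF u(1)] by simp
    fix y assume "y \<in> carrier (presented S R)"
    then obtain v where v: "v \<in> lists S" "y = word_cong S R `` {v}"
      unfolding carrier_presented by blast
    have uv: "u @ v \<in> lists S" using u(1) v(1) by simp
    show "\<phi> (x \<otimes>\<^bsub>presented S R\<^esub> y) = \<phi> x \<otimes>\<^bsub>K\<^esub> \<phi> y"
      unfolding u(2) v(2) mult_presented[OF u(1) v(1)] \<phi>[OF u(1)] \<phi>[OF v(1)] \<phi>[OF uv]
      by (rule append[OF u(1) v(1)])
  qed
  then show thesis using that \<phi> by blast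
qed

context group
begin

lemma weak_comm_class_eqI:
  assumes "(u, v) \<in> weak_comm_rels G"
    and "u \<in> lists (carrier G <+> carrier G)" and "v \<in> lists (carrier G <+> carrier G)"
  shows "word_cong (carrier G <+> carrier G) (weak_comm_rels G) `` {u}
    = word_cong (carrier G <+> carrier G) (weak_comm_rels G) `` {v}"
  using assms by (simp add: word_cong_class_eq_iff wc_rel)

lemma first_copy_hom: "first_copy G \<in> hom G (weak_comm G)"
proof (rule homI)
  show "first_copy G g \<in> carrier (weak_comm G)" if "g \<in> carrier G" for g
    using that unfolding weak_comm_def carrier_presented first_copy_def by auto
  show "first_copy G (g \<otimes> h) = first_copy G g \<otimes>\<^bsub>weak_comm G\<^esub> first_copy G h"
    if "g \<in> carrier G" "h \<in> carrier G" for g h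
  proof -
    have "first_copy G g \<otimes>\<^bsub>weak_comm G\<^esub> first_copy G h
        = word_cong (carrier G <+> carrier G) (weak_comm_rels G) `` {[Inl g] @ [Inl h]}"
      unfolding weak_comm_def first_copy_def by (rule mult_presented) (use that in auto)
    also have "\<dots> = first_copy G (g \<otimes> h)"
      unfolding first_copy_def
      by (rule weak_comm_class_eqI) (use that in \<open>auto simp: weak_comm_rels_def\<close>)
    finally show ?thesis by simp
  qed
qed

lemma second_copy_hom: "second_copy G \<in> hom G (weak_comm G)"
proof (rule homI)
  show "second_copy G g \<in> carrier (weak_comm G)" if "g \<in> carrier G" for g
    using that unfolding weak_comm_def carrier_presented second_copy_def by auto
  show "second_copy G (g \<otimes> h) = second_copy G g \<otimes>\<^bsub>weak_comm G\<^esub> second_copy G h"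
    if "g \<in> carrier G" "h \<in> carrier G" for g h
  proof -
    have "second_copy G g \<otimes>\<^bsub>weak_comm G\<^esub> second_copy G h
        = word_cong (carrier G <+> carrier G) (weak_comm_rels G) `` {[Inr g] @ [Inr h]}"
      unfolding weak_comm_def second_copy_def by (rule mult_presented) (use that in auto)
    also have "\<dots> = second_copy G (g \<otimes> h)"
      unfolding second_copy_def
      by (rule weak_comm_class_eqI) (use that in \<open>auto simp: weak_comm_rels_def\<close>)
    finally show ?thesis by simp
  qed
qed

lemma copies_commute:
  assumes g: "g \<in> carrier G"
  shows "first_copy G g \<otimes>\<^bsub>weak_comm G\<^esub> second_copy G g = second_copy G g \<otimes>\<^bsub>weak_comm G\<^esub> first_copy G g"
proof -
  interpret X: group "weak_comm G" by (rule group_weak_comm[OF is_group])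
  interpret a: group_hom G "weak_comm G" "first_copy G" by unfold_locales (rule first_copy_hom)
  interpret b: group_hom G "weak_comm G" "second_copy G" by unfold_locales (rule second_copy_hom)
  let ?S = "carrier G <+> carrier G"
  let ?cl = "\<lambda>w. word_cong ?S (weak_comm_rels G) `` {w}"
  have m: "?cl u \<otimes>\<^bsub>weak_comm G\<^esub> ?cl v = ?cl (u @ v)" if "u \<in> lists ?S" "v \<in> lists ?S" for u v
    unfolding weak_comm_def by (rule mult_presented[OF that])
  have "(first_copy G g \<otimes>\<^bsub>weak_comm G\<^esub> second_copy G g) \<otimes>\<^bsub>weak_comm G\<^esub>
      (first_copy G (inv g) \<otimes>\<^bsub>weak_comm G\<^esub> second_copy G (inv g)) = ?cl [Inl g, Inr g, Inl (inv g), Inr (inv g)]"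
    unfolding first_copy_def second_copy_def using g by (simp add: m InlI InrI)
  also have "\<dots> = ?cl []"
    by (rule weak_comm_class_eqI) (use g in \<open>auto simp: weak_comm_rels_def\<close>)
  also have "\<dots> = \<one>\<^bsub>weak_comm G\<^esub>" unfolding weak_comm_def by (rule one_presented[symmetric])
  finally have "(first_copy G g \<otimes>\<^bsub>weak_comm G\<^esub> second_copy G g) \<otimes>\<^bsub>weak_comm G\<^esub>
      inv\<^bsub>weak_comm G\<^esub> (second_copy G g \<otimes>\<^bsub>weak_comm G\<^esub> first_copy G g) = \<one>\<^bsub>weak_comm G\<^esub>"
    using g by (simp add: X.inv_mult_group)
  then show ?thesis using g by (simp add: X.inv_solve_right')
qed

lemma weak_comm_full:
  assumes "subgroup K (weak_comm G)"
    and "first_copy G ` carrier G \<subseteq> K" and "second_copy G ` carrier G \<subseteq> K"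
  shows "K = carrier (weak_comm G)"
proof
  interpret K: subgroup K "weak_comm G" by (rule assms)
  let ?S = "carrier G <+> carrier G"
  let ?cl = "\<lambda>w. word_cong ?S (weak_comm_rels G) `` {w}"
  show "K \<subseteq> carrier (weak_comm G)" by (rule K.subset)
  have "?cl w \<in> K" if "w \<in> lists ?S" for w
    using that
  proof (induction w)
    case Nil
    have "?cl [] = \<one>\<^bsub>weak_comm G\<^esub>" unfolding weak_comm_def by (rule one_presented[symmetric])
    then show ?case by simp
  next
    case (Cons s w)
    have "?cl [s] \<in> K" using Cons assms by (auto simp: first_copy_def second_copy_def)
    then have "?cl [s] \<otimes>\<^bsub>weak_comm G\<^esub> ?cl w \<in> K" using Cons by simp
    moreover have "?cl [s] \<otimes>\<^bsub>weak_comm G\<^esub> ?cl w = ?cl ([s] @ w)"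
      unfolding weak_comm_def by (rule mult_presented) (use Cons in auto)
    ultimately show ?case by simp
  qed
  then show "carrier (weak_comm G) \<subseteq> K"
    unfolding weak_comm_def subset_iff carrier_presented by blast
qed

lemma weak_comm_universal:
  assumes K: "group K" and f1: "f1 \<in> hom G K" and f2: "f2 \<in> hom G K"
    and comm: "\<And>g. g \<in> carrier G \<Longrightarrow> f1 g \<otimes>\<^bsub>K\<^esub> f2 g = f2 g \<otimes>\<^bsub>K\<^esub> f1 g"
  shows "\<exists>\<phi>\<in>hom (weak_comm G) K. \<forall>g\<in>carrier G. \<phi> (first_copy G g) = f1 g \<and> \<phi> (second_copy G g) = f2 g"
proof -
  interpret K: group K by (rule K)
  interpret f1: group_hom G K f1 by unfold_locales (rule f1)
  interpret f2: group_hom G K f2 by unfold_locales (rule f2)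
  let ?S = "carrier G <+> carrier G"
  have rel: "f1 g \<otimes>\<^bsub>K\<^esub> (f2 g \<otimes>\<^bsub>K\<^esub> (inv\<^bsub>K\<^esub> f1 g \<otimes>\<^bsub>K\<^esub> inv\<^bsub>K\<^esub> f2 g)) = \<one>\<^bsub>K\<^esub>" if "g \<in> carrier G" for g
  proof -
    have "f1 g \<otimes>\<^bsub>K\<^esub> (f2 g \<otimes>\<^bsub>K\<^esub> (inv\<^bsub>K\<^esub> f1 g \<otimes>\<^bsub>K\<^esub> inv\<^bsub>K\<^esub> f2 g))
        = (f2 g \<otimes>\<^bsub>K\<^esub> f1 g) \<otimes>\<^bsub>K\<^esub> (inv\<^bsub>K\<^esub> f1 g \<otimes>\<^bsub>K\<^esub> inv\<^bsub>K\<^esub> f2 g)"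
      unfolding comm[OF that, symmetric] using that by (simp add: K.m_assoc)
    then show ?thesis using that by (simp add: K.m_assoc)
  qed
  have closed: "case_sum f1 f2 s \<in> carrier K" if "s \<in> ?S" for s using that by auto
  have eval: "eval_word K (case_sum f1 f2) u = eval_word K (case_sum f1 f2) v"
    if "(u, v) \<in> weak_comm_rels G" for u v
    using that rel unfolding weak_comm_rels_def by (auto simp: K.m_assoc)
  obtain \<phi> where \<phi>: "\<phi> \<in> hom (weak_comm G) K"
    "\<And>w. w \<in> lists ?S \<Longrightarrow> \<phi> (word_cong ?S (weak_comm_rels G) `` {w}) = eval_word K (case_sum f1 f2) w"
  proof (rule presented_universal[OF K.is_monoid closed eval, of ?S "weak_comm_rels G"])
    fix \<phi>
    assume "\<phi> \<in> hom (presented ?S (weak_comm_rels G)) K"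
      and "\<And>w. w \<in> lists ?S \<Longrightarrow> \<phi> (word_cong ?S (weak_comm_rels G) `` {w}) = eval_word K (case_sum f1 f2) w"
    then show thesis unfolding weak_comm_def[symmetric] by (rule that)
  qed
  have "\<phi> (first_copy G g) = f1 g \<and> \<phi> (second_copy G g) = f2 g" if "g \<in> carrier G" for g
    using \<phi>(2)[of "[Inl g]"] \<phi>(2)[of "[Inr g]"] that
    by (simp add: first_copy_def second_copy_def InlI InrI)
  then show ?thesis using \<phi>(1) by blast
qed

lemma retractable_weak_comm: "retractable_copies (weak_comm G) G (first_copy G) (second_copy G)"
proof -
  interpret X: group "weak_comm G" by (rule group_weak_comm[OF is_group])
  have id: "(\<lambda>g. g) \<in> hom G G" and one: "(\<lambda>_. \<one>) \<in> hom G G" by (auto simp: hom_def)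
  show ?thesis
  proof unfold_locales
    show "K = carrier (weak_comm G)" if "subgroup K (weak_comm G)"
      "first_copy G ` carrier G \<subseteq> K" "second_copy G ` carrier G \<subseteq> K" for K
      by (rule weak_comm_full[OF that])
    show "\<exists>p\<in>hom (weak_comm G) G. \<forall>g\<in>carrier G. p (first_copy G g) = g \<and> p (second_copy G g) = \<one>"
      by (rule weak_comm_universal[OF is_group id one]) simp
    show "\<exists>p\<in>hom (weak_comm G) G. \<forall>g\<in>carrier G. p (first_copy G g) = \<one> \<and> p (second_copy G g) = g"
      by (rule weak_comm_universal[OF is_group one id]) simp
    show "\<exists>p\<in>hom (weak_comm G) G. \<forall>g\<in>carrier G. p (first_copy G g) = g \<and> p (second_copy G g) = g"
      by (rule weak_comm_universal[OF is_group id id]) simp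
  qed (rule first_copy_hom second_copy_hom copies_commute; assumption?)+
qed

end

section \<open>Passing to the quotient\<close>

text \<open>The retraction that identifies the two copies kills \<open>L(G)\<close>, and those that kill one copy kill
  \<open>D(G)\<close>. So all three factor through the quotient by a subgroup contained in both.\<close>

lemma (in retractable_copies) retractable_quotient:
  assumes N: "N \<lhd> H" and NL: "N \<subseteq> generate H {l g | g. g \<in> carrier G}"
    and ND: "N \<subseteq> commutator_subgroup H (a ` carrier G) (b ` carrier G)"
  shows "retractable_copies (H Mod N) G (\<lambda>g. N #> a g) (\<lambda>g. N #> b g)"
proof -
  interpret N: normal N H by (rule N)
  interpret Q: group "H Mod N" by (rule N.factorgroup_is_group)
  interpret q: group_hom H "H Mod N" "\<lambda>x. N #> x"
    by unfold_locales (rule N.r_coset_hom_Mod)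
  have factor: "\<exists>p'\<in>hom (H Mod N) G. \<forall>x\<in>carrier H. p' (N #> x) = p x"
    if p: "p \<in> hom H G" and ker: "N \<subseteq> kernel H G p" for p
  proof -
    interpret p: group_hom H G p by unfold_locales (rule p)
    show ?thesis using p.FactGroup_universal_kernel[OF N ker] by metis
  qed
  have retract: "\<exists>p'\<in>hom (H Mod N) G. \<forall>g\<in>carrier G. p' (N #> a g) = f g \<and> p' (N #> b g) = f' g"
    if ex: "\<exists>p\<in>hom H G. \<forall>g\<in>carrier G. p (a g) = f g \<and> p (b g) = f' g"
      and ff: "(\<forall>g\<in>carrier G. f g = f' g) \<or> (\<forall>g\<in>carrier G. f g = \<one>\<^bsub>G\<^esub>) \<or> (\<forall>g\<in>carrier G. f' g = \<one>\<^bsub>G\<^esub>)"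
    for f f'
  proof -
    obtain p where p: "p \<in> hom H G" "\<And>g. g \<in> carrier G \<Longrightarrow> p (a g) = f g"
      "\<And>g. g \<in> carrier G \<Longrightarrow> p (b g) = f' g" using ex by blast
    interpret p: group_hom H G p by unfold_locales (rule p)
    have fG: "f g \<in> carrier G" "f' g \<in> carrier G" if "g \<in> carrier G" for g
      using that p.hom_closed[of "a g"] p.hom_closed[of "b g"] p by auto
    have "N \<subseteq> kernel H G p"
    proof (cases "\<forall>g\<in>carrier G. f g = f' g")
      case True
      then have "{l g | g. g \<in> carrier G} \<subseteq> kernel H G p" by (auto simp: kernel_def p fG)
      then show ?thesis using NL H.generate_subgroup_incl[OF _ p.subgroup_kernel] by blast
    next
      case False
      then have "(\<forall>g\<in>carrier G. f g = \<one>\<^bsub>G\<^esub>) \<or> (\<forall>g\<in>carrier G. f' g = \<one>\<^bsub>G\<^esub>)" using ff by blast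
      then have "{x \<otimes> y \<otimes> inv x \<otimes> inv y | x y. x \<in> a ` carrier G \<and> y \<in> b ` carrier G} \<subseteq> kernel H G p"
        by (auto simp: kernel_def p fG)
      then show ?thesis
        using ND H.generate_subgroup_incl[OF _ p.subgroup_kernel] unfolding commutator_subgroup_def by blast
    qed
    then obtain p' where "p' \<in> hom (H Mod N) G" "\<forall>x\<in>carrier H. p' (N #> x) = p x"
      using factor[OF p(1)] by blast
    then show ?thesis using p by (intro bexI[of _ p']) auto
  qed
  show ?thesis
  proof unfold_locales
    show "(\<lambda>g. N #> a g) \<in> hom G (H Mod N)" and "(\<lambda>g. N #> b g) \<in> hom G (H Mod N)"
      using Group.hom_compose[OF a_hom q.homh] Group.hom_compose[OF b_hom q.homh] by (simp_all add: comp_def)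
    show "(N #> a g) \<otimes>\<^bsub>H Mod N\<^esub> (N #> b g) = (N #> b g) \<otimes>\<^bsub>H Mod N\<^esub> (N #> a g)"
      if "g \<in> carrier G" for g
      using commute[OF that] that q.hom_mult[of "a g" "b g"] q.hom_mult[of "b g" "a g"] by simp
    show "K = carrier (H Mod N)"
      if K: "subgroup K (H Mod N)" "(\<lambda>g. N #> a g) ` carrier G \<subseteq> K" "(\<lambda>g. N #> b g) ` carrier G \<subseteq> K" for K
    proof -
      interpret K: subgroup K "H Mod N" by (rule K)
      have "\<one> \<in> {x \<in> carrier H. N #> x \<in> K}" using q.hom_one K.one_closed by (auto simp del: one_FactGroup)
      then have "subgroup {x \<in> carrier H. N #> x \<in> K} H"
        by (intro H.subgroupI)
          (use q.hom_inv q.hom_mult K.m_inv_closed K.m_closed in \<open>auto simp del: mult_FactGroup\<close>)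
      then have "{x \<in> carrier H. N #> x \<in> K} = carrier H" using K(2,3) by (intro full) auto
      then show ?thesis using K.subset by (auto simp: carrier_FactGroup)
    qed
  qed (rule retract[OF retract_first] retract[OF retract_second] retract[OF retract_both]; simp)+
qed

text \<open>All members of a class pull back to the same class, so the union in \<open>sphere_pullback\<close>
  is over a constant family.\<close>

lemma (in normal) sphere_pullback_class:
  assumes "is_character (G Mod H) \<psi>"
  shows "sphere_pullback G (\<lambda>x. H #> x) (char_class (G Mod H) \<psi>) = char_class G (\<lambda>x. \<psi> (H #> x))"
proof -
  have "char_class G (\<psi>' \<circ> (\<lambda>x. H #> x)) = char_class G (\<lambda>x. \<psi> (H #> x))"
    if \<psi>': "\<psi>' \<in> char_class (G Mod H) \<psi>" for \<psi>'
  proof -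
    obtain r where "r > 0" "\<forall>h\<in>carrier (G Mod H). \<psi>' h = r * \<psi> h"
      using \<psi>' unfolding char_class_def by blast
    then show ?thesis by (intro char_class_eqI[of r]) (auto simp: carrier_FactGroup)
  qed
  moreover have "\<psi> \<in> char_class (G Mod H) \<psi>"
    unfolding char_class_def by (auto intro!: exI[of _ 1] assms)
  ultimately show ?thesis unfolding sphere_pullback_def by blast
qed

lemma (in normal) is_character_pullback:
  "is_character (G Mod H) \<psi> \<Longrightarrow> is_character G (\<lambda>x. \<psi> (H #> x))"
  by (rule is_character_compose[OF r_coset_hom_Mod]) (simp_all add: carrier_FactGroup)

lemma (in normal) character_descends:
  assumes \<chi>: "is_character G \<chi>" and zero: "\<And>h. h \<in> H \<Longrightarrow> \<chi> h = 0"
  obtains \<psi> where "is_character (G Mod H) \<psi>" and "\<And>x. x \<in> carrier G \<Longrightarrow> \<psi> (H #> x) = \<chi> x"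
proof -
  interpret R: group real_group by (rule group_real_group)
  interpret c: group_hom G real_group \<chi>
    by unfold_locales (use \<chi> in \<open>simp add: is_character_def\<close>)
  have "H \<subseteq> kernel G real_group \<chi>"
    using zero subset by (auto simp: kernel_def real_group_def)
  then obtain \<psi> where \<psi>: "\<psi> \<in> hom (G Mod H) real_group" "\<And>x. x \<in> carrier G \<Longrightarrow> \<psi> (H #> x) = \<chi> x"
    using c.FactGroup_universal_kernel[OF normal_axioms] by blast
  moreover have "is_character (G Mod H) \<psi>"
    using \<chi> \<psi> unfolding is_character_def by (auto simp: carrier_FactGroup)
  ultimately show thesis using that by blast
qed

lemma (in normal) bij_betw_sphere_pullback:
  assumes "\<And>\<chi> h. is_character G \<chi> \<Longrightarrow> h \<in> H \<Longrightarrow> \<chi> h = 0"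
  shows "bij_betw (sphere_pullback G (\<lambda>x. H #> x)) (char_sphere (G Mod H)) (char_sphere G)"
proof (rule bij_betw_imageI)
  show "inj_on (sphere_pullback G (\<lambda>x. H #> x)) (char_sphere (G Mod H))"
  proof (rule inj_onI)
    fix A B assume "A \<in> char_sphere (G Mod H)" "B \<in> char_sphere (G Mod H)"
      and eq: "sphere_pullback G (\<lambda>x. H #> x) A = sphere_pullback G (\<lambda>x. H #> x) B"
    then obtain \<phi> \<psi> where \<phi>: "is_character (G Mod H) \<phi>" "A = char_class (G Mod H) \<phi>"
      and \<psi>: "is_character (G Mod H) \<psi>" "B = char_class (G Mod H) \<psi>"
      by (auto simp: char_sphere_def)
    have "char_class G (\<lambda>x. \<phi> (H #> x)) = char_class G (\<lambda>x. \<psi> (H #> x))"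
      using eq unfolding \<phi>(2) \<psi>(2) sphere_pullback_class[OF \<phi>(1)] sphere_pullback_class[OF \<psi>(1)] .
    then obtain r where "0 < r" "\<And>x. x \<in> carrier G \<Longrightarrow> \<phi> (H #> x) = r * \<psi> (H #> x)"
      using char_class_eqD[OF is_character_pullback[OF \<phi>(1)]] by metis
    then show "A = B"
      unfolding \<phi>(2) \<psi>(2) by (intro char_class_eqI[of r]) (auto simp: carrier_FactGroup)
  qed
  show "sphere_pullback G (\<lambda>x. H #> x) ` char_sphere (G Mod H) = char_sphere G"
  proof (intro equalityI subsetI)
    fix C assume "C \<in> sphere_pullback G (\<lambda>x. H #> x) ` char_sphere (G Mod H)"
    then obtain \<psi> where "is_character (G Mod H) \<psi>"
      "C = sphere_pullback G (\<lambda>x. H #> x) (char_class (G Mod H) \<psi>)"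
      by (auto simp: char_sphere_def)
    then show "C \<in> char_sphere G"
      using is_character_pullback sphere_pullback_class by (auto simp: char_sphere_def)
  next
    fix C assume "C \<in> char_sphere G"
    then obtain \<chi> where \<chi>: "is_character G \<chi>" "C = char_class G \<chi>" by (auto simp: char_sphere_def)
    then obtain \<psi> where \<psi>: "is_character (G Mod H) \<psi>" "\<And>x. x \<in> carrier G \<Longrightarrow> \<psi> (H #> x) = \<chi> x"
      using character_descends assms by metis
    have "C = char_class G (\<lambda>x. \<psi> (H #> x))"
      unfolding \<chi>(2) by (rule char_class_eqI[of 1]) (use \<psi> in auto)
    then show "C \<in> sphere_pullback G (\<lambda>x. H #> x) ` char_sphere (G Mod H)"
      using \<psi>(1) sphere_pullback_class[OF \<psi>(1)] by (auto simp: char_sphere_def)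
  qed
qed

lemma (in group) character_commutator_subgroup:
  assumes \<chi>: "is_character G \<chi>" and "A \<subseteq> carrier G" and "B \<subseteq> carrier G"
    and "h \<in> commutator_subgroup G A B"
  shows "\<chi> h = 0"
proof -
  have zero: "\<chi> (x \<otimes> y \<otimes> inv x \<otimes> inv y) = 0" if "x \<in> carrier G" "y \<in> carrier G" for x y
    using that by (simp add: is_character_mult[OF \<chi>] is_character_inv[OF \<chi>])
  interpret R: group real_group by (rule group_real_group)
  interpret c: group_hom G real_group \<chi>
    by unfold_locales (use \<chi> in \<open>simp add: is_character_def\<close>)
  have "{x \<otimes> y \<otimes> inv x \<otimes> inv y | x y. x \<in> A \<and> y \<in> B} \<subseteq> kernel G real_group \<chi>"
  proof clarify
    fix x y assume "x \<in> A" "y \<in> B"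
    then have xy: "x \<in> carrier G" "y \<in> carrier G" using assms by auto
    then show "x \<otimes> y \<otimes> inv x \<otimes> inv y \<in> kernel G real_group \<chi>"
      using zero[OF xy] unfolding kernel_def by (simp add: real_group_def del: c.hom_mult c.hom_inv)
  qed
  then have "h \<in> kernel G real_group \<chi>"
    using generate_subgroup_incl[OF _ c.subgroup_kernel] assms(4) unfolding commutator_subgroup_def by blast
  then show ?thesis by (simp add: kernel_def real_group_def)
qed

theorem theoremA:
  fixes G :: "('a, 'b) monoid_scheme"
  assumes "group G" and "finitely_generated G"
  shows "(\<forall>\<chi> \<chi>1 \<chi>2.
      is_character (weak_comm G) \<chi> \<longrightarrow>
      \<chi>1 = (\<lambda>g. \<chi> (first_copy G g)) \<longrightarrow> \<chi>2 = (\<lambda>g. \<chi> (second_copy G g)) \<longrightarrow>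
      (char_class (weak_comm G) \<chi> \<in> Sigma1 (weak_comm G) \<longleftrightarrow>
         (\<exists>g\<in>carrier G. \<chi>1 g \<noteq> 0) \<and> (\<exists>g\<in>carrier G. \<chi>2 g \<noteq> 0) \<and>
           (\<exists>g\<in>carrier G. \<chi>1 g \<noteq> \<chi>2 g) \<or>
         (\<forall>g\<in>carrier G. \<chi>1 g = 0) \<and> char_class G \<chi>2 \<in> Sigma1 G \<or>
         (\<forall>g\<in>carrier G. \<chi>2 g = 0) \<and> char_class G \<chi>1 \<in> Sigma1 G \<or>
         (\<forall>g\<in>carrier G. \<chi>1 g = \<chi>2 g) \<and> (\<exists>g\<in>carrier G. \<chi>1 g \<noteq> 0) \<and>
           char_class G \<chi>1 \<in> Sigma1 G))
    \<and> bij_betw (sphere_pullback (weak_comm G) (\<lambda>x. W_subgroup G #>\<^bsub>weak_comm G\<^esub> x))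
        (char_sphere (weak_comm G Mod W_subgroup G)) (char_sphere (weak_comm G))
    \<and> sphere_pullback (weak_comm G) (\<lambda>x. W_subgroup G #>\<^bsub>weak_comm G\<^esub> x) `
        Sigma1 (weak_comm G Mod W_subgroup G) = Sigma1 (weak_comm G)"
proof -
  interpret X: retractable_copies "weak_comm G" G "first_copy G" "second_copy G"
    by (rule group.retractable_weak_comm[OF assms(1)])
  let ?X = "weak_comm G" and ?W = "W_subgroup G"
  let ?q = "\<lambda>x. ?W #>\<^bsub>?X\<^esub> x"
  have W: "?W \<lhd> ?X"
    unfolding W_subgroup_def L_subgroup_def D_subgroup_def
    by (rule X.H.normal_subgroup_intersect[OF X.normal_generate_l X.normal_commutator_subgroup])
  interpret W: normal ?W ?X by (rule W)
  interpret Q: retractable_copies "?X Mod ?W" G "\<lambda>g. ?q (first_copy G g)" "\<lambda>g. ?q (second_copy G g)"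
    by (rule X.retractable_quotient[OF W])
      (auto simp: W_subgroup_def L_subgroup_def D_subgroup_def)
  have zero: "\<chi> w = 0" if "is_character ?X \<chi>" "w \<in> ?W" for \<chi> w
  proof (rule X.H.character_commutator_subgroup[OF that(1)])
    show "w \<in> commutator_subgroup ?X (first_copy G ` carrier G) (second_copy G ` carrier G)"
      using that(2) by (simp add: W_subgroup_def D_subgroup_def)
  qed auto
  have bij: "bij_betw (sphere_pullback ?X ?q) (char_sphere (?X Mod ?W)) (char_sphere ?X)"
    by (rule W.bij_betw_sphere_pullback) (rule zero)
  have iff: "char_class ?X (\<lambda>x. \<psi> (?q x)) \<in> Sigma1 ?X \<longleftrightarrow> char_class (?X Mod ?W) \<psi> \<in> Sigma1 (?X Mod ?W)"
    if "is_character (?X Mod ?W) \<psi>" for \<psi>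
    unfolding X.Sigma1_iff_copies[OF assms(2) W.is_character_pullback[OF that]]
      Q.Sigma1_iff_copies[OF assms(2) that] ..
  have "sphere_pullback ?X ?q ` Sigma1 (?X Mod ?W) = Sigma1 ?X"
  proof (intro equalityI subsetI)
    fix C assume "C \<in> sphere_pullback ?X ?q ` Sigma1 (?X Mod ?W)"
    then obtain A where A: "A \<in> Sigma1 (?X Mod ?W)" "C = sphere_pullback ?X ?q A" by blast
    then obtain \<psi> where \<psi>: "is_character (?X Mod ?W) \<psi>" "A = char_class (?X Mod ?W) \<psi>"
      unfolding Sigma1_def by blast
    show "C \<in> Sigma1 ?X"
      using A iff[OF \<psi>(1)] unfolding \<psi>(2) W.sphere_pullback_class[OF \<psi>(1)] by simp
  next
    fix C assume C: "C \<in> Sigma1 ?X"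
    then have "C \<in> char_sphere ?X" unfolding Sigma1_def char_sphere_def by blast
    then have "C \<in> sphere_pullback ?X ?q ` char_sphere (?X Mod ?W)"
      using bij by (simp add: bij_betw_def)
    then obtain \<psi> where \<psi>: "is_character (?X Mod ?W) \<psi>"
      "C = sphere_pullback ?X ?q (char_class (?X Mod ?W) \<psi>)"
      unfolding char_sphere_def by blast
    then have "char_class (?X Mod ?W) \<psi> \<in> Sigma1 (?X Mod ?W)"
      using C iff[OF \<psi>(1)] W.sphere_pullback_class[OF \<psi>(1)] by simp
    then show "C \<in> sphere_pullback ?X ?q ` Sigma1 (?X Mod ?W)" using \<psi>(2) by blast
  qed
  then show ?thesis using bij X.Sigma1_iff_copies[OF assms(2)] by simp
qed

end
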